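(* Let $X$ be a finite pure $d$-dimensional weighted simplicial complex. Assume that for every face $\sigma\in X$ with $\dim\sigma<d-2$ (including $\sigma=\emptyset$) a real number $\lambda_\sigma$ is given such that $\lambda_2\big(M^{X_\sigma}_0\big)\le\lambda_\sigma$. For $-1\le j\le d-3$ put $\gamma_j=\max_{\sigma\in X(j)}\lambda_\sigma$. Let $0\le k\le d-2$, and for each $0\le i\le k$ let $f_i\in C^k(X)$ be a proper $i$-level cochain. Then \[ \Big\langle M_k\sum_{i=0}^{k}f_i,\ \sum_{i=0}^{k}f_i\Big\rangle\ \le\ \sum_{i=0}^{k}\Big(1-\frac{1}{k-i+1}\prod_{j=i-1}^{k-1}(1-\gamma_j)\Big)\lVert f_i\rVert^2 . \]
   Context: $X(i)$ is the set of $i$-dimensional faces ($|\sigma|=i+1$), $X(-1)=\{\emptyset\}$; pure means every face lies in a $d$-face. The weight $w$ satisfies $w>0$, $\sum_{\sigma\in X(d)}w(\sigma)=1$, and for $\tau\in X(i)$, $i<d$: $w(\tau)=\binom{d+1}{i+1}^{-1}\sum_{\sigma\in X(d),\sigma\supseteq\tau}w(\sigma)$. The link of $\sigma\in X(i)$ is $X_\sigma=\{\tau\setminus\sigma:\sigma\subseteq\tau\in X\}$ with weights $w_\sigma(\tau)=\frac{w(\tau\cup\sigma)}{\binom{i+j+2}{i+1}w(\sigma)}$ for $\tau\in X_\sigma(j)$ (so $X_\emptyset=X$). $C^k(Y)$ is the space of functions $Y(k)\to\mathbb R$ with inner product $\langle f,g\rangle=\sum_{\sigma\in Y(k)}w(\sigma)f(\sigma)g(\sigma)$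 (using the link weights on a link); $\mathbb 1$ is the constant function $1$. The non-lazy walk on $C^k(Y)$ is $(M_kf)(\sigma)=\frac{1}{k+1}\sum_{\tau\in Y(k):\,\sigma\cup\tau\in Y(k+1)}w_\sigma(\tau\setminus\sigma)f(\tau)$ (weights $w_\sigma$ taken in $Y$); $M^{X_\sigma}_0$ is this operator on $C^0(X_\sigma)$ and $\lambda_2$ denotes its second largest eigenvalue (it is self-adjoint). Localization: for $f\in C^k(X)$, $\sigma\in X(i)$, $i\le k$, $f_\sigma\in C^{k-i-1}(X_\sigma)$, $f_\sigma(\tau)=f(\sigma\cup\tau)$. A cochain $f\in C^k(X)$ is $i$-level if $\langle f_\sigma,\mathbb 1\rangle_\sigma=0$ for every $\sigma\in X(i-1)$ (inner product in $X_\sigma$); it is proper $i$-level if it is $i$-level and orthogonal to every $(i+1)$-level cochain in $C^k(X)$.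
   Formalization: The formal theorem also assumes γ_j ≤ 1 for 0 ≤ j ≤ k−1; without it the claim fails (full simplex on 4 vertices, k=1, all λ_σ=3, f_1=0, f_0≠0: left side 0, right side −‖f_0‖²). Since λ_2 ≤ 1 always, only uninformative bounds are excluded. *)

theory Defs
  imports Complex_Main "HOL-Library.Function_Algebras" "HOL-Library.Indicator_Function"
begin

text \<open>Dimensions are integers, since they start at -1 (the empty face).\<close>

definition face_dim :: "'a set \<Rightarrow> int" where
  "face_dim \<sigma> = int (card \<sigma>) - 1"

definition faces :: "'a set set \<Rightarrow> int \<Rightarrow> 'a set set" where
  "faces X i = {\<sigma> \<in> X. face_dim \<sigma> = i}"

definition finite_complex :: "'a set set \<Rightarrow> bool" where
  "finite_complex X \<longleftrightarrow>
     finite X \<and> {} \<in> X \<and> (\<forall>\<sigma>\<in>X. finite \<sigma>) \<and> (\<forall>\<sigma>\<in>X. \<forall>\<tau>. \<tau> \<subseteq> \<sigma> \<longrightarrow> \<tau> \<in> X)"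

definition pure_complex :: "'a set set \<Rightarrow> int \<Rightarrow> bool" where
  "pure_complex X d \<longleftrightarrow> finite_complex X \<and> (\<forall>\<sigma>\<in>X. \<exists>\<tau>\<in>faces X d. \<sigma> \<subseteq> \<tau>)"

definition weighted_complex :: "'a set set \<Rightarrow> int \<Rightarrow> ('a set \<Rightarrow> real) \<Rightarrow> bool" where
  "weighted_complex X d w \<longleftrightarrow>
     pure_complex X d \<and>
     (\<forall>\<sigma>\<in>X. 0 < w \<sigma>) \<and>
     (\<Sum>\<sigma>\<in>faces X d. w \<sigma>) = 1 \<and>
     (\<forall>i<d. \<forall>\<tau>\<in>faces X i.
        w \<tau> = (\<Sum>\<sigma> | \<sigma> \<in> faces X d \<and> \<tau> \<subseteq> \<sigma>. w \<sigma>) / real (nat (d + 1) choose nat (i + 1)))"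

definition link :: "'a set set \<Rightarrow> 'a set \<Rightarrow> 'a set set" where
  "link X \<sigma> = {\<tau> - \<sigma> |\<tau>. \<tau> \<in> X \<and> \<sigma> \<subseteq> \<tau>}"

text \<open>With \<open>i = face_dim \<sigma>\<close> and \<open>j = face_dim \<tau>\<close> the binomial coefficient is
  \<open>i + j + 2\<close> over \<open>i + 1\<close>.\<close>

definition link_weight :: "('a set \<Rightarrow> real) \<Rightarrow> 'a set \<Rightarrow> 'a set \<Rightarrow> real" where
  "link_weight w \<sigma> \<tau> = w (\<tau> \<union> \<sigma>) / (real (card \<sigma> + card \<tau> choose card \<sigma>) * w \<sigma>)"

text \<open>Functions on the \<open>k\<close>-faces are represented by their extension by zero; in particular
  the constant function 1 is the indicator of the set of \<open>k\<close>-faces.\<close>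

definition cochains :: "'a set set \<Rightarrow> int \<Rightarrow> ('a set \<Rightarrow> real) set" where
  "cochains Y k = {f. \<forall>\<sigma>. \<sigma> \<notin> faces Y k \<longrightarrow> f \<sigma> = 0}"

definition one_cochain :: "'a set set \<Rightarrow> int \<Rightarrow> 'a set \<Rightarrow> real" where
  "one_cochain Y k = indicator (faces Y k)"

definition cochain_inner ::
  "'a set set \<Rightarrow> ('a set \<Rightarrow> real) \<Rightarrow> int \<Rightarrow> ('a set \<Rightarrow> real) \<Rightarrow> ('a set \<Rightarrow> real) \<Rightarrow> real" where
  "cochain_inner Y w k f g = (\<Sum>\<sigma>\<in>faces Y k. w \<sigma> * f \<sigma> * g \<sigma>)"

definition cochain_norm ::
  "'a set set \<Rightarrow> ('a set \<Rightarrow> real) \<Rightarrow> int \<Rightarrow> ('a set \<Rightarrow> real) \<Rightarrow> real" where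
  "cochain_norm Y w k f = sqrt (cochain_inner Y w k f f)"

definition nonlazy_walk ::
  "'a set set \<Rightarrow> ('a set \<Rightarrow> real) \<Rightarrow> int \<Rightarrow> ('a set \<Rightarrow> real) \<Rightarrow> 'a set \<Rightarrow> real" where
  "nonlazy_walk Y w k f \<sigma> =
     (if \<sigma> \<in> faces Y k
      then (\<Sum>\<tau> | \<tau> \<in> faces Y k \<and> \<sigma> \<union> \<tau> \<in> faces Y (k + 1). link_weight w \<sigma> (\<tau> - \<sigma>) * f \<tau>)
             / of_int (k + 1)
      else 0)"

definition localize :: "'a set set \<Rightarrow> int \<Rightarrow> ('a set \<Rightarrow> real) \<Rightarrow> 'a set \<Rightarrow> 'a set \<Rightarrow> real" where
  "localize X k f \<sigma> \<tau> =
     (if \<tau> \<in> faces (link X \<sigma>) (k - face_dim \<sigma> - 1) then f (\<sigma> \<union> \<tau>) else 0)"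

definition level ::
  "'a set set \<Rightarrow> ('a set \<Rightarrow> real) \<Rightarrow> int \<Rightarrow> int \<Rightarrow> ('a set \<Rightarrow> real) \<Rightarrow> bool" where
  "level X w k i f \<longleftrightarrow>
     f \<in> cochains X k \<and>
     (\<forall>\<sigma>\<in>faces X (i - 1).
        cochain_inner (link X \<sigma>) (link_weight w \<sigma>) (k - i)
          (localize X k f \<sigma>) (one_cochain (link X \<sigma>) (k - i)) = 0)"

definition proper_level ::
  "'a set set \<Rightarrow> ('a set \<Rightarrow> real) \<Rightarrow> int \<Rightarrow> int \<Rightarrow> ('a set \<Rightarrow> real) \<Rightarrow> bool" where
  "proper_level X w k i f \<longleftrightarrow>
     level X w k i f \<and> (\<forall>g. level X w k (i + 1) g \<longrightarrow> cochain_inner X w k f g = 0)"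

global_interpretation rfun: vector_space "\<lambda>(c::real) f (x::'b). c * f x"
  by unfold_locales (simp_all add: fun_eq_iff algebra_simps)

definition eigenspace :: "('b \<Rightarrow> real) set \<Rightarrow> (('b \<Rightarrow> real) \<Rightarrow> 'b \<Rightarrow> real) \<Rightarrow> real \<Rightarrow> ('b \<Rightarrow> real) set"
  where "eigenspace V T \<mu> = {f \<in> V. T f = (\<lambda>x. \<mu> * f x)}"

definition eigenvalues :: "('b \<Rightarrow> real) set \<Rightarrow> (('b \<Rightarrow> real) \<Rightarrow> 'b \<Rightarrow> real) \<Rightarrow> real set" where
  "eigenvalues V T = {\<mu>. \<exists>f\<in>eigenspace V T \<mu>. f \<noteq> 0}"

text \<open>The second largest eigenvalue, counted with multiplicity, of a self-adjoint operator \<open>T\<close> on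
  a space \<open>V\<close> of dimension at least 2: the largest eigenvalue \<open>\<mu>\<close> such that at least two
  eigenvalues, counted with multiplicity, are at least \<open>\<mu>\<close>.\<close>

definition second_eigenvalue :: "('b \<Rightarrow> real) set \<Rightarrow> (('b \<Rightarrow> real) \<Rightarrow> 'b \<Rightarrow> real) \<Rightarrow> real" where
  "second_eigenvalue V T =
     Max {\<mu> \<in> eigenvalues V T.
            2 \<le> (\<Sum>\<nu> | \<nu> \<in> eigenvalues V T \<and> \<mu> \<le> \<nu>. rfun.dim (eigenspace V T \<nu>))}"

definition link_lambda2 :: "'a set set \<Rightarrow> ('a set \<Rightarrow> real) \<Rightarrow> 'a set \<Rightarrow> real" where
  "link_lambda2 X w \<sigma> =
     second_eigenvalue (cochains (link X \<sigma>) 0) (nonlazy_walk (link X \<sigma>) (link_weight w \<sigma>) 0)"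

end

theory Submission
  imports Defs "HOL-Analysis.Function_Topology"
begin

text \<open>Write \<open>D\<close> for the averaging operator from \<open>C\<^sup>k\<close> to \<open>C\<^sup>k\<^sup>-\<^sup>1\<close> and \<open>U\<close> for its adjoint.
  Localizing to the links of the \<open>(k-1)\<close>-faces (Garland's method), the spectral bound gives
  \<open>\<langle>M\<^sub>k f, f\<rangle> \<le> \<gamma> \<parallel>f\<parallel>\<^sup>2 + (1 - \<gamma>) \<parallel>D f\<parallel>\<^sup>2\<close> with \<open>\<gamma> = \<gamma>\<^sub>k\<^sub>-\<^sub>1\<close>, while
  \<open>(k+1) \<parallel>U g\<parallel>\<^sup>2 = \<parallel>g\<parallel>\<^sup>2 + k \<langle>M\<^sub>k\<^sub>-\<^sub>1 g, g\<rangle>\<close> for \<open>g \<in> C\<^sup>k\<^sup>-\<^sup>1\<close>. By induction on \<open>k\<close> it remains to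
  turn a diagonal bound on \<open>\<parallel>U g\<parallel>\<^sup>2\<close> with coefficients \<open>b\<^sub>i\<close> into the same bound on \<open>\<parallel>D f\<parallel>\<^sup>2\<close>.
  Neither operator preserves the proper levels, but both preserve the level filtrations (\<open>D\<close> the
  spaces of level at least \<open>i\<close>, \<open>U\<close> their complements), which suffices
  because the \<open>b\<^sub>i\<close> decrease in \<open>i\<close>. That monotonicity rests on a lower bound for \<open>\<lambda>\<^sub>2\<close> of a link,
  obtained from the test functions \<open>\<one>\<^sub>v - w(v)\<close>.\<close>

section \<open>Weighted inner products on spaces of functions\<close>

text \<open>The abstract form of \<open>cochains\<close>: extension by zero makes equality of
  functions the same as equality on \<open>S\<close>.\<close>

definition vanishing_off :: "'b set \<Rightarrow> ('b \<Rightarrow> real) set" where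
  "vanishing_off S = {f. \<forall>x. x \<notin> S \<longrightarrow> f x = 0}"

definition wip :: "'b set \<Rightarrow> ('b \<Rightarrow> real) \<Rightarrow> ('b \<Rightarrow> real) \<Rightarrow> ('b \<Rightarrow> real) \<Rightarrow> real" where
  "wip S p f g = (\<Sum>x\<in>S. p x * f x * g x)"

lemma sum_fun_apply: "sum f A x = (\<Sum>i\<in>A. f i x)"
  for f :: "'i \<Rightarrow> 'b \<Rightarrow> real"
  by (induction A rule: infinite_finite_induct) auto

lemma wip_commute: "wip S p f g = wip S p g f"
  by (simp add: wip_def mult_ac)

lemma wip_add_left: "wip S p (f + g) h = wip S p f h + wip S p g h"
  by (simp add: wip_def algebra_simps sum.distrib)

lemma wip_add_right: "wip S p h (f + g) = wip S p h f + wip S p h g"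
  by (simp add: wip_def algebra_simps sum.distrib)

lemma wip_diff_left: "wip S p (f - g) h = wip S p f h - wip S p g h"
  by (simp add: wip_def algebra_simps sum_subtractf)

lemma wip_diff_right: "wip S p h (f - g) = wip S p h f - wip S p h g"
  by (simp add: wip_def algebra_simps sum_subtractf)

lemma wip_scale_left: "wip S p (\<lambda>x. c * f x) h = c * wip S p f h"
  by (simp add: wip_def algebra_simps sum_distrib_left)

lemma wip_scale_right: "wip S p h (\<lambda>x. c * f x) = c * wip S p h f"
  by (simp add: wip_def algebra_simps sum_distrib_left)

lemma wip_zero_left: "wip S p 0 h = 0"
  by (simp add: wip_def)

lemma wip_zero_right: "wip S p h 0 = 0"
  by (simp add: wip_def)

lemma wip_pointwise:
  "wip S p (\<lambda>x. f x + g x) h = wip S p f h + wip S p g h"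
  "wip S p h (\<lambda>x. f x + g x) = wip S p h f + wip S p h g"
  "wip S p (\<lambda>x. f x - g x) h = wip S p f h - wip S p g h"
  "wip S p h (\<lambda>x. f x - g x) = wip S p h f - wip S p h g"
  "wip S p (\<lambda>x. 0) h = 0" "wip S p h (\<lambda>x. 0) = 0"
  by (simp_all add: wip_def algebra_simps sum.distrib sum_subtractf)

lemmas wip_simps = wip_add_left wip_add_right wip_diff_left wip_diff_right
  wip_scale_left wip_scale_right wip_zero_left wip_zero_right wip_pointwise

lemma wip_sum_left: "wip S p (sum f A) h = (\<Sum>i\<in>A. wip S p (f i) h)"
  by (induction A rule: infinite_finite_induct) (simp_all add: wip_simps)

lemma wip_sum_right: "wip S p h (sum f A) = (\<Sum>i\<in>A. wip S p h (f i))"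
  by (induction A rule: infinite_finite_induct) (simp_all add: wip_simps)

text \<open>Near \<open>t = 0\<close> the linear term dominates; the choice
  \<open>t = - b / (c + 1)\<close> already makes the expression negative when \<open>b\<close> is
  nonzero. This serves as the first-order condition at a maximizer of a quadratic form.\<close>

lemma nonneg_linear_perturbation_imp_zero:
  fixes b c :: real
  assumes "\<And>t. 0 \<le> 2 * t * b + t\<^sup>2 * c" and c: "0 \<le> c"
  shows "b = 0"
proof (rule ccontr)
  assume b: "b \<noteq> 0"
  have "0 \<le> 2 * (- b / (c + 1)) * b + (- b / (c + 1))\<^sup>2 * c"
    by (rule assms)
  also have "\<dots> = b\<^sup>2 * (c - 2 * (c + 1)) / (c + 1)\<^sup>2"
    using c by (simp add: divide_simps power2_eq_square) (simp add: algebra_simps)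
  also have "\<dots> < 0"
    using b c by (intro divide_neg_pos mult_pos_neg) auto
  finally show False by simp
qed

text \<open>Abel summation: all tails of \<open>u i = z i - b i * q i\<close> are nonpositive, and
  the weights \<open>1 / b i\<close> are positive and increase with \<open>i\<close>, so the
  weighted sum of \<open>u\<close> is nonpositive too.\<close>

lemma weighted_tail_sum_bound:
  fixes z q b :: "nat \<Rightarrow> real"
  assumes tail: "\<And>m. m < n \<Longrightarrow> (\<Sum>i=m..<n. z i) \<le> (\<Sum>i=m..<n. b i * q i)"
    and pos: "\<And>i. i < n \<Longrightarrow> 0 < b i"
    and anti: "\<And>i. Suc i < n \<Longrightarrow> b (Suc i) \<le> b i"
  shows "(\<Sum>i<n. z i / b i) \<le> (\<Sum>i<n. q i)"
proof (cases "n = 0")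
  case False
  define u where "u i = z i - b i * q i" for i
  have u: "(\<Sum>i=m..<n. u i) \<le> 0" if "m < n" for m
    using tail[OF that] by (simp add: u_def sum_subtractf)
  have "(\<Sum>i=m..<n. u i / b i) \<le> (\<Sum>i=m..<n. u i) / b m" if "m \<le> n - 1" for m
    using that
  proof (induction m rule: inc_induct)
    case base
    show ?case using False by (cases n) simp_all
  next
    case (step m)
    then have m: "m < n" "Suc m < n" by auto
    \<comment> \<open>The tail is nonpositive, so passing to the larger divisor \<open>b m\<close>
      can only increase the quotient.\<close>
    have "(\<Sum>i=Suc m..<n. u i) / b (Suc m) \<le> (\<Sum>i=Suc m..<n. u i) / b m"
      using u[OF m(2)] anti[OF m(2)] pos m by (intro divide_left_mono_neg) auto
    then show ?case
      using step.IH m(1) by (simp add: sum.atLeast_Suc_lessThan add_divide_distrib)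
  qed
  from this[of 0] have "(\<Sum>i<n. u i / b i) \<le> (\<Sum>i=0..<n. u i) / b 0"
    by (simp add: lessThan_atLeast0)
  also have "\<dots> \<le> 0"
    using u[of 0] pos[of 0] False by (intro divide_nonpos_pos) auto
  also have "(\<Sum>i<n. u i / b i) = (\<Sum>i<n. z i / b i) - (\<Sum>i<n. q i)"
  proof -
    have "(\<Sum>i<n. u i / b i) = (\<Sum>i<n. z i / b i - q i)"
      using pos by (intro sum.cong refl) (force simp: u_def diff_divide_distrib)
    then show ?thesis by (simp add: sum_subtractf)
  qed
  finally show ?thesis by simp
qed simp

section \<open>Linear algebra in the space of functions on a finite weighted set\<close>

locale weighted_space =
  fixes S :: "'b set" and p :: "'b \<Rightarrow> real"
  assumes finite_S: "finite S" and p_pos: "x \<in> S \<Longrightarrow> 0 < p x"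
begin

abbreviation V :: "('b \<Rightarrow> real) set" where "V \<equiv> vanishing_off S"

abbreviation ip :: "('b \<Rightarrow> real) \<Rightarrow> ('b \<Rightarrow> real) \<Rightarrow> real" where "ip \<equiv> wip S p"

lemma ip_nonneg: "0 \<le> ip f f"
  unfolding wip_def using p_pos
  by (intro sum_nonneg) (simp add: less_imp_le mult.assoc)

lemma ip_eq_0_iff: "f \<in> V \<Longrightarrow> ip f f = 0 \<longleftrightarrow> f = 0"
proof
  assume f: "f \<in> V" "ip f f = 0"
  have "\<forall>x\<in>S. p x * f x * f x = 0"
    using f(2) unfolding wip_def
    by (subst (asm) sum_nonneg_eq_0_iff) (auto simp: finite_S p_pos less_imp_le mult.assoc)
  then have "f x = 0" for x
    using f(1) p_pos by (cases "x \<in> S") (fastforce simp: vanishing_off_def)+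
  then show "f = 0" by (simp add: fun_eq_iff)
qed (simp add: wip_simps)

lemma subspace_V: "rfun.subspace V"
  by (simp add: rfun.subspace_def vanishing_off_def)

lemma V_subset_span:
  "V \<subseteq> rfun.span ((\<lambda>x. indicator {x}) ` S)"
proof
  fix f assume f: "f \<in> V"
  have "f = (\<Sum>x\<in>S. (\<lambda>y. f x * indicator {x} y))"
  proof
    fix y
    have "(\<Sum>x\<in>S. f x * indicator {x} y) = (\<Sum>x\<in>S. if x = y then f x else 0)"
      by (intro sum.cong) (auto simp: indicator_def)
    then show "f y = (\<Sum>x\<in>S. (\<lambda>y. f x * indicator {x} y)) y"
      using f finite_S by (auto simp: sum_fun_apply vanishing_off_def)
  qed
  also have "\<dots> \<in> rfun.span ((\<lambda>x. indicator {x}) ` S)"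
    by (intro rfun.span_sum rfun.span_scale rfun.span_base) auto
  finally show "f \<in> rfun.span ((\<lambda>x. indicator {x}) ` S)" .
qed

lemma finite_independent: "rfun.independent B \<Longrightarrow> B \<subseteq> V \<Longrightarrow> finite B"
  using rfun.independent_span_bound[of "(\<lambda>x. indicator {x}) ` S" B] V_subset_span finite_S
  by auto

lemma orthogonal_independent:
  assumes V: "B \<subseteq> V" and "0 \<notin> B"
    and orth: "\<And>f g. f \<in> B \<Longrightarrow> g \<in> B \<Longrightarrow> f \<noteq> g \<Longrightarrow> ip f g = 0"
  shows "rfun.independent B"
  unfolding rfun.independent_explicit_finite_subsets
proof (intro allI impI ballI)
  fix A u v
  assume A: "A \<subseteq> B" "finite A" and 0: "(\<Sum>v\<in>A. (\<lambda>x. u v * v x)) = 0" and v: "v \<in> A"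
  have "0 = ip (\<Sum>v\<in>A. (\<lambda>x. u v * v x)) v"
    by (simp add: 0 wip_simps)
  also have "\<dots> = (\<Sum>g\<in>A. u g * ip g v)"
    by (simp add: wip_sum_left wip_simps)
  also have "\<dots> = (\<Sum>g\<in>A. if g = v then u v * ip v v else 0)"
    using A v orth by (intro sum.cong) auto
  also have "\<dots> = u v * ip v v"
    using A v by simp
  finally have "u v * ip v v = 0" by simp
  moreover have "ip v v \<noteq> 0"
    using ip_eq_0_iff[of v] V A v \<open>0 \<notin> B\<close> by auto
  ultimately show "u v = 0" by simp
qed

text \<open>Extend \<open>B\<close> to a maximal independent subset of \<open>W\<close>. Inside
  \<open>V\<close> that set is finite, so its cardinality can be compared with that of
  \<open>B\<close>.\<close>

lemma card_le_dim:
  assumes "rfun.independent B" "B \<subseteq> W" "W \<subseteq> V"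
  shows "card B \<le> rfun.dim W"
proof -
  obtain B' where B': "B \<subseteq> B'" "B' \<subseteq> W" "rfun.independent B'" "W \<subseteq> rfun.span B'"
    using rfun.maximal_independent_subset_extend[OF assms(2,1)] .
  have "finite B'"
    using B' assms(3) finite_independent by blast
  moreover have "rfun.span B' = rfun.span W"
    using B' by (intro equalityI rfun.span_mono rfun.span_minimal) (auto simp: rfun.subspace_span)
  then have "rfun.dim W = card B'"
    using B' by (intro rfun.dim_eq_card)
  ultimately show ?thesis
    using B'(1) by (simp add: card_mono)
qed

text \<open>Gram-Schmidt, one vector at a time: the component \<open>e\<close> of the new vector
  \<open>a\<close> orthogonal to the span of \<open>B\<close> spans the only new direction, and
  projecting onto that line is explicit.\<close>

lemma span_projection:
  assumes "finite B" "B \<subseteq> V" "f \<in> V"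
  shows "\<exists>q\<in>rfun.span B. \<forall>g\<in>rfun.span B. ip (f - q) g = 0"
  using assms
proof (induction B arbitrary: f rule: finite_induct)
  case empty
  then show ?case by (auto simp: wip_simps)
next
  case (insert a B)
  have B: "rfun.span B \<subseteq> rfun.span (insert a B)"
    by (intro rfun.span_mono) auto
  obtain q where q: "q \<in> rfun.span B" "\<forall>g\<in>rfun.span B. ip (f - q) g = 0"
    using insert by blast
  obtain r where r: "r \<in> rfun.span B" "\<forall>g\<in>rfun.span B. ip (a - r) g = 0"
    using insert by blast
  define e where "e = a - r"
  have e: "e \<in> rfun.span (insert a B)"
    unfolding e_def using r(1) B by (intro rfun.span_diff) (auto simp: rfun.span_base)
  have sub: "rfun.span (insert a B) \<subseteq> V"
    using insert.prems by (intro rfun.span_minimal subspace_V)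
  \<comment> \<open>If \<open>e = 0\<close>, then \<open>a\<close> already lies in the span of
    \<open>B\<close> and nothing has to be added.\<close>
  define c where "c = (if e = 0 then 0 else ip f e / ip e e)"
  define q' where "q' = q + (\<lambda>x. c * e x)"
  have "ip q e = 0"
    using r(2) q(1) by (simp add: e_def wip_commute)
  then have fe: "ip (f - q') e = 0"
    using ip_eq_0_iff[of e] e sub by (auto simp: q'_def c_def wip_simps)
  have fB: "ip (f - q') g = 0" if "g \<in> rfun.span B" for g
  proof -
    have "f - q' = (f - q) - (\<lambda>x. c * e x)" by (simp add: q'_def)
    then have "ip (f - q') g = ip (f - q) g - c * ip e g"
      by (simp only: wip_diff_left[of _ _ "f - q"] wip_scale_left)
    then show ?thesis using q(2) r(2) that by (simp add: e_def)
  qed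
  have "ip (f - q') g = 0" if "g \<in> rfun.span (insert a B)" for g
  proof -
    have "a = e + r" by (simp add: e_def)
    then have a: "ip (f - q') a = 0"
      using fe fB[OF r(1)] by (metis wip_add_right add_0)
    show ?thesis
      using that
    proof (induction rule: rfun.span_induct)
      case base
      show ?case by (simp add: rfun.subspace_def wip_simps)
    next
      case (step x)
      then show ?case using a fB rfun.span_base by (metis insertE)
    qed
  qed
  moreover have "q' \<in> rfun.span (insert a B)"
    unfolding q'_def using q(1) B e by (intro rfun.span_add rfun.span_scale) auto
  ultimately show ?case by blast
qed

lemma orthogonal_projection:
  assumes W: "rfun.subspace W" "W \<subseteq> V" and f: "f \<in> V"
  obtains q where "q \<in> W" "\<And>g. g \<in> W \<Longrightarrow> ip (f - q) g = 0"
proof -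
  obtain B where B: "B \<subseteq> W" "rfun.independent B" "W \<subseteq> rfun.span B"
    using rfun.maximal_independent_subset .
  have "rfun.span B = W"
    using B W by (simp add: rfun.span_subspace)
  moreover have "finite B" "B \<subseteq> V"
    using B W finite_independent by blast+
  ultimately show ?thesis
    using span_projection[of B f] f that by blast
qed

lemma ip_orthogonal_sum:
  assumes "finite A" "\<And>i j. i \<in> A \<Longrightarrow> j \<in> A \<Longrightarrow> i \<noteq> j \<Longrightarrow> ip (f i) (f j) = 0"
  shows "ip (\<Sum>i\<in>A. f i) (\<Sum>i\<in>A. f i) = (\<Sum>i\<in>A. ip (f i) (f i))"
proof -
  have "ip (\<Sum>i\<in>A. f i) (\<Sum>i\<in>A. f i) = (\<Sum>i\<in>A. \<Sum>j\<in>A. ip (f i) (f j))"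
    by (simp only: wip_sum_left) (simp only: wip_sum_right)
  also have "\<dots> = (\<Sum>i\<in>A. \<Sum>j\<in>A. if j = i then ip (f i) (f i) else 0)"
    using assms(2) by (intro sum.cong refl) auto
  finally show ?thesis using assms(1) by simp
qed

text \<open>Terms with \<open>ip (f i) (f i) = 0\<close> contribute 0, by the convention on division by zero.\<close>

lemma bessel:
  assumes "finite A" and orth: "\<And>i j. i \<in> A \<Longrightarrow> j \<in> A \<Longrightarrow> i \<noteq> j \<Longrightarrow> ip (f i) (f j) = 0"
  shows "(\<Sum>i\<in>A. (ip (f i) v)\<^sup>2 / ip (f i) (f i)) \<le> ip v v"
proof -
  define c where "c i = ip (f i) v / ip (f i) (f i)" for i
  define s where "s = (\<Sum>i\<in>A. (\<lambda>x. c i * f i x))"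
  let ?B = "\<Sum>i\<in>A. (ip (f i) v)\<^sup>2 / ip (f i) (f i)"
  have "ip s s = (\<Sum>i\<in>A. ip (\<lambda>x. c i * f i x) (\<lambda>x. c i * f i x))"
    unfolding s_def using assms by (intro ip_orthogonal_sum) (simp_all add: wip_scale_left wip_scale_right)
  also have "\<dots> = ?B"
  proof (intro sum.cong refl)
    fix i
    have "c i * (c i * ip (f i) (f i)) = (ip (f i) v)\<^sup>2 / ip (f i) (f i)"
      by (simp add: c_def power2_eq_square)
    then show "ip (\<lambda>x. c i * f i x) (\<lambda>x. c i * f i x) = (ip (f i) v)\<^sup>2 / ip (f i) (f i)"
      by (simp only: wip_scale_left wip_scale_right)
  qed
  finally have "ip s s = ?B" .
  moreover have "ip s v = ?B"
    by (simp only: s_def wip_sum_left wip_scale_left) (simp add: c_def power2_eq_square)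
  moreover have "0 \<le> ip (v - s) (v - s)" by (rule ip_nonneg)
  ultimately show ?thesis
    using wip_commute[of S p v s] by (simp only: wip_diff_left wip_diff_right)
qed

end

section \<open>Spectral bounds for reversible Markov kernels\<close>

text \<open>A reversible Markov chain with stationary measure \<open>p\<close>. The total mass of
  \<open>p\<close> is left free; lemmas about probability measures assume it separately.\<close>

locale reversible_kernel = weighted_space S p for S :: "'b set" and p :: "'b \<Rightarrow> real" +
  fixes P :: "'b \<Rightarrow> 'b \<Rightarrow> real"
  assumes P_nonneg: "x \<in> S \<Longrightarrow> y \<in> S \<Longrightarrow> 0 \<le> P x y"
    and reversible: "x \<in> S \<Longrightarrow> y \<in> S \<Longrightarrow> p x * P x y = p y * P y x"
    and stochastic: "x \<in> S \<Longrightarrow> (\<Sum>y\<in>S. P x y) = 1"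
begin

definition T :: "('b \<Rightarrow> real) \<Rightarrow> 'b \<Rightarrow> real" where
  "T f x = (if x \<in> S then \<Sum>y\<in>S. P x y * f y else 0)"

definition one :: "'b \<Rightarrow> real" where "one = indicator S"

lemma T_in_V: "T f \<in> V"
  by (simp add: T_def vanishing_off_def)

lemma one_in_V: "one \<in> V"
  by (simp add: one_def vanishing_off_def)

lemma T_one: "T one = one"
  by (auto simp: T_def one_def fun_eq_iff stochastic)

lemma T_add: "T (f + g) = T f + T g"
  by (auto simp: T_def fun_eq_iff algebra_simps sum.distrib)

lemma T_diff: "T (f - g) = T f - T g"
  by (auto simp: T_def fun_eq_iff algebra_simps sum_subtractf)

lemma T_scale: "T (\<lambda>x. c * f x) = (\<lambda>x. c * T f x)"
  by (auto simp: T_def fun_eq_iff algebra_simps sum_distrib_left)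

lemma ip_T: "ip (T f) g = (\<Sum>x\<in>S. \<Sum>y\<in>S. p x * P x y * f y * g x)"
  by (simp add: wip_def T_def sum_distrib_left sum_distrib_right mult_ac)

lemma T_selfadjoint: "ip (T f) g = ip f (T g)"
proof -
  have "ip (T f) g = (\<Sum>y\<in>S. \<Sum>x\<in>S. p x * P x y * f y * g x)"
    unfolding ip_T by (rule sum.swap)
  also have "\<dots> = (\<Sum>y\<in>S. \<Sum>x\<in>S. p y * P y x * g x * f y)"
    by (intro sum.cong refl) (simp add: reversible mult_ac)
  finally show ?thesis
    by (simp add: ip_T[symmetric] wip_commute[of S p f])
qed

text \<open>Bound each product \<open>f x * f y\<close> by the mean of the two squares. The sum of
  one square collapses by stochasticity, that of the other by reversibility first. Hence no
  eigenvalue exceeds 1.\<close>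

lemma T_le_id: "ip (T f) f \<le> ip f f"
proof -
  have "ip (T f) f \<le> (\<Sum>x\<in>S. \<Sum>y\<in>S. (p x * P x y * (f x)\<^sup>2 + p x * P x y * (f y)\<^sup>2) / 2)"
    unfolding ip_T
  proof (intro sum_mono)
    fix x y assume xy: "x \<in> S" "y \<in> S"
    have "f y * f x \<le> ((f x)\<^sup>2 + (f y)\<^sup>2) / 2"
      using sum_squares_bound[of "f x" "f y"] by (simp add: mult_ac)
    then have "(p x * P x y) * (f y * f x) \<le> (p x * P x y) * (((f x)\<^sup>2 + (f y)\<^sup>2) / 2)"
      using xy p_pos P_nonneg by (intro mult_left_mono) (auto simp: less_imp_le)
    then show "p x * P x y * f y * f x \<le> (p x * P x y * (f x)\<^sup>2 + p x * P x y * (f y)\<^sup>2) / 2"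
      by (simp add: algebra_simps)
  qed
  also have "\<dots> = ((\<Sum>x\<in>S. \<Sum>y\<in>S. p x * P x y * (f x)\<^sup>2) + (\<Sum>x\<in>S. \<Sum>y\<in>S. p x * P x y * (f y)\<^sup>2)) / 2"
    by (simp add: sum_divide_distrib[symmetric] sum.distrib)
  also have "(\<Sum>x\<in>S. \<Sum>y\<in>S. p x * P x y * (f y)\<^sup>2) = (\<Sum>y\<in>S. \<Sum>x\<in>S. p y * P y x * (f y)\<^sup>2)"
    by (subst sum.swap) (intro sum.cong refl, simp add: reversible)
  also have "(\<Sum>x\<in>S. \<Sum>y\<in>S. p x * P x y * (f x)\<^sup>2) = ip f f"
    by (simp add: wip_def sum_distrib_left[symmetric] sum_distrib_right[symmetric] stochastic
        power2_eq_square mult.assoc)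
  finally show ?thesis by simp
qed

section \<open>Eigenvalues and their variational characterization\<close>

lemma eigenvector_orthogonal:
  assumes "f \<in> eigenspace V T \<mu>" "g \<in> eigenspace V T \<nu>" "\<mu> \<noteq> \<nu>"
  shows "ip f g = 0"
proof -
  have "\<mu> * ip f g = ip (T f) g"
    using assms(1) by (simp add: eigenspace_def wip_simps)
  also have "\<dots> = \<nu> * ip f g"
    using assms(2) by (simp add: T_selfadjoint eigenspace_def wip_simps)
  finally show ?thesis using assms(3) by simp
qed

text \<open>One eigenvector per eigenvalue gives an orthogonal, hence independent, family in a
  finite-dimensional space.\<close>

lemma finite_eigenvalues: "finite (eigenvalues V T)"
proof -
  have "\<forall>\<mu>\<in>eigenvalues V T. \<exists>f. f \<in> eigenspace V T \<mu> \<and> f \<noteq> 0"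
    by (auto simp: eigenvalues_def)
  then obtain e where e: "\<And>\<mu>. \<mu> \<in> eigenvalues V T \<Longrightarrow> e \<mu> \<in> eigenspace V T \<mu> \<and> e \<mu> \<noteq> 0"
    by metis
  have V: "e ` eigenvalues V T \<subseteq> V"
    using e by (auto simp: eigenspace_def)
  have "inj_on e (eigenvalues V T)"
  proof (rule inj_onI, rule ccontr)
    fix \<mu> \<nu> assume mn: "\<mu> \<in> eigenvalues V T" "\<nu> \<in> eigenvalues V T" "e \<mu> = e \<nu>" "\<mu> \<noteq> \<nu>"
    then have "ip (e \<mu>) (e \<mu>) = 0"
      using eigenvector_orthogonal e by metis
    then show False
      using ip_eq_0_iff[of "e \<mu>"] V e mn(1) by auto
  qed
  moreover have "rfun.independent (e ` eigenvalues V T)"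
    using e eigenvector_orthogonal by (intro orthogonal_independent[OF V]) (auto, metis)
  then have "finite (e ` eigenvalues V T)"
    using V finite_independent by blast
  ultimately show ?thesis by (simp add: finite_image_iff)
qed

lemma eigenspace_subset_V: "eigenspace V T \<mu> \<subseteq> V"
  by (auto simp: eigenspace_def)

text \<open>The constant function has eigenvalue 1, which is at least \<open>\<mu>\<close> by
  \<open>T_le_id\<close>. Together with \<open>g\<close>, orthogonal to it, this gives two
  eigenvalues at least \<open>\<mu>\<close> with multiplicity, so \<open>\<mu>\<close> is a
  candidate in the \<open>Max\<close> defining \<open>second_eigenvalue\<close>.\<close>

lemma le_second_eigenvalue:
  assumes g: "g \<in> eigenspace V T \<mu>" "g \<noteq> 0" "ip g one = 0" and one: "one \<noteq> 0"
  shows "\<mu> \<le> second_eigenvalue V T"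
proof -
  have gV: "g \<in> V" using g(1) eigenspace_subset_V by blast
  have one1: "one \<in> eigenspace V T 1"
    by (simp add: eigenspace_def one_in_V T_one)
  have "\<mu> * ip g g \<le> ip g g"
    using T_le_id[of g] g(1) by (simp add: eigenspace_def wip_simps)
  moreover have "ip g g > 0"
    using ip_nonneg[of g] ip_eq_0_iff[OF gV] g(2) by linarith
  ultimately have \<mu>1: "\<mu> \<le> 1" by simp
  have gone: "g \<noteq> one"
    using g(3) one ip_eq_0_iff[OF one_in_V] by auto
  let ?E = "{\<nu> \<in> eigenvalues V T. \<mu> \<le> \<nu>}"
  have fin: "finite ?E" using finite_eigenvalues by simp
  have \<mu>E: "\<mu> \<in> ?E" and oneE: "1 \<in> ?E"
    using g one1 one \<mu>1 by (auto simp: eigenvalues_def)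
  have "2 \<le> (\<Sum>\<nu>\<in>?E. rfun.dim (eigenspace V T \<nu>))"
  \<comment> \<open>For \<open>\<mu> = 1\<close> both dimensions come from a single eigenspace, so
    \<open>g\<close> and \<open>one\<close> must be shown independent; otherwise two different
    eigenspaces contribute at least one each.\<close>
  proof (cases "\<mu> = 1")
    case True
    have "card {g, one} \<le> rfun.dim (eigenspace V T 1)"
    proof (rule card_le_dim[OF _ _ eigenspace_subset_V])
      show "rfun.independent {g, one}"
        using gV one_in_V g one by (intro orthogonal_independent) (auto simp: wip_commute)
    qed (use g one1 True in auto)
    also have "\<dots> \<le> (\<Sum>\<nu>\<in>?E. rfun.dim (eigenspace V T \<nu>))"
      using fin oneE by (intro member_le_sum) auto
    finally show ?thesis using gone by simp
  next
    case False
    have dim: "1 \<le> rfun.dim (eigenspace V T \<nu>)" if "h \<in> eigenspace V T \<nu>" "h \<noteq> 0" for h \<nu>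
      using card_le_dim[of "{h}" "eigenspace V T \<nu>"] that eigenspace_subset_V
      by (auto simp: rfun.dependent_single)
    have "2 \<le> (\<Sum>\<nu>\<in>{\<mu>, 1}. rfun.dim (eigenspace V T \<nu>))"
      using dim[OF g(1,2)] dim[OF one1 one] False by simp
    also have "\<dots> \<le> (\<Sum>\<nu>\<in>?E. rfun.dim (eigenspace V T \<nu>))"
      using fin \<mu>E oneE by (intro sum_mono2) auto
    finally show ?thesis .
  qed
  then have "\<mu> \<in> {\<mu> \<in> eigenvalues V T.
      2 \<le> (\<Sum>\<nu> | \<nu> \<in> eigenvalues V T \<and> \<mu> \<le> \<nu>. rfun.dim (eigenspace V T \<nu>))}"
    using \<mu>E by simp
  then show ?thesis
    unfolding second_eigenvalue_def using finite_eigenvalues by (intro Max_ge) auto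
qed

text \<open>In the product topology the set is a closed subset of a product of compact intervals.
  This compactness yields the maximizer of the Rayleigh quotient.\<close>

lemma compact_orthogonal_sphere: "compact {g \<in> V. ip g one = 0 \<and> ip g g = 1}"
proof -
  \<comment> \<open>On the unit sphere \<open>(g x)\<^sup>2\<close> is at most
    \<open>1 / p x\<close>, and \<open>1 / p x + 1\<close> dominates the square root of this. Off
    \<open>S\<close> the interval degenerates to 0, which encodes membership in
    \<open>V\<close>.\<close>
  define R where "R x = (if x \<in> S then 1 / p x + 1 else 0)" for x
  have "compactin (product_topology (\<lambda>_. euclidean) UNIV) (PiE UNIV (\<lambda>x. {- R x..R x}))"
    by (subst compactin_PiE) auto
  then have box: "compact (PiE UNIV (\<lambda>x. {- R x..R x}))"
    by (simp add: euclidean_product_topology)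
  have cont: "continuous_on UNIV (\<lambda>g. ip g one)" "continuous_on UNIV (\<lambda>g. ip g g)"
    unfolding wip_def by (intro continuous_intros continuous_on_product_coordinates)+
  have "closed ({g. ip g one = 0} \<inter> {g. ip g g = 1})"
    using cont by (intro closed_Int closed_Collect_eq continuous_on_const)
  with box have "compact (PiE UNIV (\<lambda>x. {- R x..R x}) \<inter> ({g. ip g one = 0} \<inter> {g. ip g g = 1}))"
    by (rule compact_Int_closed)
  also have "PiE UNIV (\<lambda>x. {- R x..R x}) \<inter> ({g. ip g one = 0} \<inter> {g. ip g g = 1})
    = {g \<in> V. ip g one = 0 \<and> ip g g = 1}"
  proof (intro equalityI subsetI)
    fix g assume g: "g \<in> {g \<in> V. ip g one = 0 \<and> ip g g = 1}"
    have "\<bar>g x\<bar> \<le> R x" for x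
    proof (cases "x \<in> S")
      case True
      have "p x * g x * g x \<le> 1"
        using g member_le_sum[of x S "\<lambda>x. p x * g x * g x"] True finite_S p_pos
        by (auto simp: wip_def mult.assoc less_imp_le)
      then have "(g x)\<^sup>2 \<le> 1 / p x"
        using p_pos[OF True] by (simp add: field_simps power2_eq_square)
      also have "\<dots> \<le> (R x)\<^sup>2"
        using p_pos[OF True] True by (simp add: R_def power2_eq_square algebra_simps)
      finally show ?thesis
        using p_pos[OF True] by (simp add: R_def True abs_le_square_iff[symmetric])
    qed (use g in \<open>simp add: R_def vanishing_off_def\<close>)
    then show "g \<in> PiE UNIV (\<lambda>x. {- R x..R x}) \<inter> ({g. ip g one = 0} \<inter> {g. ip g g = 1})"
      using g by (auto simp: abs_le_iff minus_le_iff)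
  next
    fix g assume g: "g \<in> PiE UNIV (\<lambda>x. {- R x..R x}) \<inter> ({g. ip g one = 0} \<inter> {g. ip g g = 1})"
    have "g x = 0" if "x \<notin> S" for x
    proof -
      have "g x \<in> {- R x..R x}" using g by (auto simp: PiE_iff)
      then show ?thesis using that by (simp add: R_def)
    qed
    then show "g \<in> {g \<in> V. ip g one = 0 \<and> ip g g = 1}"
      using g by (auto simp: vanishing_off_def)
  qed
  finally show ?thesis .
qed

text \<open>A maximizer of the Rayleigh quotient on the orthogonal complement of the constants is an
  eigenvector. The function \<open>u\<close> witnesses that this complement is nonzero, so that
  there is something to maximize over.\<close>

lemma exists_maximal_eigenvector:
  assumes u: "u \<in> V" "u \<noteq> 0" "ip u one = 0"
  obtains g \<mu> where "g \<in> eigenspace V T \<mu>" "g \<noteq> 0" "ip g one = 0"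
    "\<And>f. f \<in> V \<Longrightarrow> ip f one = 0 \<Longrightarrow> ip (T f) f \<le> \<mu> * ip f f"
proof -
  let ?Z = "{g \<in> V. ip g one = 0 \<and> ip g g = 1}"
  have normalize: "(\<lambda>x. 1 / sqrt (ip f f) * f x) \<in> ?Z" if "f \<in> V" "f \<noteq> 0" "ip f one = 0" for f
  proof -
    have "0 < ip f f"
      using that ip_nonneg[of f] ip_eq_0_iff[of f] by linarith
    then show ?thesis
      using that unfolding mem_Collect_eq wip_scale_left wip_scale_right
      by (simp add: vanishing_off_def)
  qed
  have "?Z \<noteq> {}" using normalize[OF u] by blast
  moreover have "continuous_on ?Z (\<lambda>g. ip (T g) g)"
    unfolding ip_T
    by (rule continuous_on_subset[OF _ subset_UNIV])
      (intro continuous_intros continuous_on_product_coordinates)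
  ultimately obtain g where g: "g \<in> ?Z" "\<And>f. f \<in> ?Z \<Longrightarrow> ip (T f) f \<le> ip (T g) g"
    using continuous_attains_sup[OF compact_orthogonal_sphere] by blast
  define \<mu> where "\<mu> = ip (T g) g"
  have max: "ip (T f) f \<le> \<mu> * ip f f" if f: "f \<in> V" "ip f one = 0" for f
  proof (cases "f = 0")
    case False
    define n where "n = ip f f"
    have n: "0 < n"
      using ip_nonneg[of f] ip_eq_0_iff[OF f(1)] False by (simp add: n_def)
    have "ip (T (\<lambda>x. 1 / sqrt n * f x)) (\<lambda>x. 1 / sqrt n * f x) \<le> \<mu>"
      unfolding \<mu>_def n_def using normalize[OF f(1) False f(2)] by (rule g(2))
    then have "ip (T f) f / n \<le> \<mu>"
      using n unfolding T_scale wip_scale_left wip_scale_right by simp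
    then show ?thesis using n by (simp add: n_def divide_simps)
  qed (simp add: wip_simps T_scale)
  \<comment> \<open>The residual of the eigenvalue equation is an admissible direction, since
    \<open>T\<close> is self-adjoint and fixes \<open>one\<close>. Moving \<open>g\<close> along
    \<open>r\<close>, the first-order gain is \<open>ip r r\<close>, which must therefore vanish at
    the maximizer.\<close>
  define r where "r = T g - (\<lambda>x. \<mu> * g x)"
  have r: "r \<in> V" "ip r one = 0"
    using g(1) T_in_V[of g] by (auto simp: r_def vanishing_off_def wip_simps T_selfadjoint T_one)
  have "- ip r r = 0"
  proof (rule nonneg_linear_perturbation_imp_zero)
    fix t
    define h where "h = g + (\<lambda>x. t * r x)"
    have "ip (T h) h \<le> \<mu> * ip h h"
      using g(1) r by (intro max) (auto simp: h_def vanishing_off_def wip_simps)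
    moreover have "ip (T h) h = \<mu> + 2 * t * ip (T g) r + t\<^sup>2 * ip (T r) r"
      using T_selfadjoint[of r g] wip_commute[of S p r "T g"]
      unfolding h_def T_add T_scale
      by (simp add: wip_simps \<mu>_def algebra_simps power2_eq_square)
    moreover have "ip h h = 1 + 2 * t * ip g r + t\<^sup>2 * ip r r"
      using g(1) wip_commute[of S p r g]
      unfolding h_def by (simp add: wip_simps algebra_simps power2_eq_square)
    ultimately have "0 \<le> 2 * t * (- (ip (T g) r - \<mu> * ip g r)) + t\<^sup>2 * (\<mu> * ip r r - ip (T r) r)"
      by (simp add: algebra_simps)
    also have "ip (T g) r - \<mu> * ip g r = ip r r"
    proof -
      have "ip r r = ip (T g - (\<lambda>x. \<mu> * g x)) r" by (simp only: r_def)
      then show ?thesis by (simp only: wip_diff_left wip_scale_left)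
    qed
    finally show "0 \<le> 2 * t * (- ip r r) + t\<^sup>2 * (\<mu> * ip r r - ip (T r) r)" .
  next
    show "0 \<le> \<mu> * ip r r - ip (T r) r" using max[OF r] by simp
  qed
  then have "r = 0" using ip_eq_0_iff r by simp
  then have "T g = (\<lambda>x. \<mu> * g x)"
    by (simp add: r_def fun_eq_iff)
  then have "g \<in> eigenspace V T \<mu>" using g(1) by (simp add: eigenspace_def)
  moreover have "g \<noteq> 0" using g(1) by (auto simp: wip_simps)
  ultimately show ?thesis using that g(1) max by blast
qed

text \<open>A nonzero \<open>f\<close> itself supplies the nonzero vector needed for a maximal
  eigenvector, whose eigenvalue is then bounded by \<open>second_eigenvalue\<close>. For
  \<open>f = 0\<close> both sides vanish.\<close>

lemma rayleigh_le_second_eigenvalue: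
  assumes f: "f \<in> V" "ip f one = 0"
  shows "ip (T f) f \<le> second_eigenvalue V T * ip f f"
proof (cases "f = 0")
  case False
  obtain g \<mu> where g: "g \<in> eigenspace V T \<mu>" "g \<noteq> 0" "ip g one = 0"
    "ip (T f) f \<le> \<mu> * ip f f"
    using exists_maximal_eigenvector[OF f(1) False f(2)] f by metis
  have "S \<noteq> {}" using f(1) False by (auto simp: vanishing_off_def)
  then have "one \<noteq> 0" by (auto simp: one_def fun_eq_iff indicator_def)
  then have "\<mu> \<le> second_eigenvalue V T" using le_second_eigenvalue g by blast
  then show ?thesis
    using g(4) mult_right_mono[OF _ ip_nonneg[of f]] by force
qed (simp add: wip_simps)

text \<open>Split \<open>f\<close> into its mean and the fluctuation \<open>h\<close>:
  \<open>T\<close> fixes the constants, which have norm 1, and the spectral bound applies to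
  \<open>h\<close>.\<close>

lemma quadratic_form_le:
  assumes mass: "(\<Sum>x\<in>S. p x) = 1" and l: "second_eigenvalue V T \<le> l" and f: "f \<in> V"
  shows "ip (T f) f \<le> l * ip f f + (1 - l) * (ip f one)\<^sup>2"
proof -
  define c where "c = ip f one"
  define h where "h = f - (\<lambda>x. c * one x)"
  have one: "ip one one = 1" using mass by (simp add: wip_def one_def)
  have "h \<in> V" using f one_in_V by (simp add: h_def vanishing_off_def)
  moreover have "ip h one = 0" by (simp add: h_def wip_simps one c_def)
  ultimately have "ip (T h) h \<le> second_eigenvalue V T * ip h h"
    by (rule rayleigh_le_second_eigenvalue)
  also have "\<dots> \<le> l * ip h h" using l ip_nonneg by (rule mult_right_mono)
  finally have "ip (T h) h \<le> l * ip h h" .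
  moreover have "ip (T h) h = ip (T f) f - c\<^sup>2"
    unfolding h_def T_diff T_scale T_one
    using T_selfadjoint[of f one] wip_commute[of S p f one]
    by (simp add: wip_simps one T_one c_def power2_eq_square)
  moreover have "ip h h = ip f f - c\<^sup>2"
    unfolding h_def using wip_commute[of S p f one]
    by (simp add: wip_simps one c_def power2_eq_square)
  ultimately show ?thesis by (simp add: c_def algebra_simps)
qed

text \<open>Test the Rayleigh bound on the centred point masses \<open>f = e - p v\<close>. The zero
  diagonal gives \<open>ip (T f) f = - (p v)\<^sup>2\<close>, against the norm
  \<open>p v * (1 - p v)\<close>; dividing by \<open>p v\<close> and summing over \<open>v\<close>
  brings in the cardinality of \<open>S\<close>.\<close>

lemma second_eigenvalue_lower_bound:
  assumes mass: "(\<Sum>x\<in>S. p x) = 1" and diag: "\<And>x. x \<in> S \<Longrightarrow> P x x = 0"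
    and neg: "second_eigenvalue V T < 0"
  shows "-1 \<le> second_eigenvalue V T * (real (card S) - 1)"
proof -
  define l where "l = second_eigenvalue V T"
  have "- p v \<le> l * (1 - p v)" if v: "v \<in> S" for v
  proof -
    define e :: "'b \<Rightarrow> real" where "e = indicator {v}"
    define f where "f = e - (\<lambda>x. p v * one x)"
    have e: "e \<in> V" using v by (auto simp: e_def vanishing_off_def indicator_def)
    have "ip h e = p v * h v" for h
    proof -
      have "ip h e = (\<Sum>x\<in>S. if x = v then p v * h v else 0)"
        unfolding wip_def e_def by (intro sum.cong) (auto simp: indicator_def)
      then show ?thesis using v finite_S by simp
    qed note he = this
    have 1: "ip e e = p v" "ip one e = p v" "ip e one = p v" "ip one one = 1"
      using he[of e] he[of one] v mass wip_commute[of S p e one]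
      by (auto simp: e_def one_def wip_def)
    have "T e v = 0"
    proof -
      have "T e v = (\<Sum>y\<in>S. if y = v then P v v else 0)"
        unfolding T_def e_def using v by (auto intro!: sum.cong simp: indicator_def)
      then show ?thesis using diag[OF v] v finite_S by simp
    qed
    then have 2: "ip e (T e) = 0" using he[of "T e"] by (metis mult_zero_right wip_commute)
    have "f \<in> V" using e one_in_V by (simp add: f_def vanishing_off_def)
    moreover have "ip f one = 0" by (simp add: f_def wip_simps 1)
    ultimately have "ip (T f) f \<le> l * ip f f"
      unfolding l_def by (rule rayleigh_le_second_eigenvalue)
    moreover have "ip (T f) f = - (p v)\<^sup>2"
      unfolding f_def T_diff T_scale T_one
      by (simp add: wip_simps 1 2 T_selfadjoint T_one power2_eq_square)
    moreover have "ip f f = p v * (1 - p v)"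
      unfolding f_def by (simp add: wip_simps 1 algebra_simps)
    ultimately have "p v * (- p v) \<le> p v * (l * (1 - p v))"
      by (simp add: power2_eq_square mult_ac)
    then show ?thesis using p_pos[OF v] mult_le_cancel_left_pos by blast
  qed
  then have "(\<Sum>v\<in>S. - p v) \<le> (\<Sum>v\<in>S. l * (1 - p v))" by (intro sum_mono)
  then show ?thesis
    by (simp add: sum_negf mass sum_distrib_left[symmetric] sum_subtractf l_def)
qed

end

section \<open>Weighted simplicial complexes\<close>

text \<open>Removing \<open>\<sigma>\<close> turns the intermediate sets into the subsets of
  \<open>\<rho> - \<sigma>\<close> of a fixed size.\<close>

lemma card_between:
  assumes "finite \<rho>" "\<sigma> \<subseteq> \<rho>" "card \<sigma> \<le> m"
  shows "card {\<tau>. \<sigma> \<subseteq> \<tau> \<and> \<tau> \<subseteq> \<rho> \<and> card \<tau> = m} = (card \<rho> - card \<sigma>) choose (m - card \<sigma>)"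
proof -
  have fin: "finite \<sigma>" using assms finite_subset by blast
  have "bij_betw (\<lambda>\<tau>. \<tau> - \<sigma>) {\<tau>. \<sigma> \<subseteq> \<tau> \<and> \<tau> \<subseteq> \<rho> \<and> card \<tau> = m}
    {\<upsilon>. \<upsilon> \<subseteq> \<rho> - \<sigma> \<and> card \<upsilon> = m - card \<sigma>}"
  proof (rule bij_betwI[where g = "\<lambda>\<upsilon>. \<upsilon> \<union> \<sigma>"])
    show "(\<lambda>\<upsilon>. \<upsilon> \<union> \<sigma>) \<in> {\<upsilon>. \<upsilon> \<subseteq> \<rho> - \<sigma> \<and> card \<upsilon> = m - card \<sigma>} \<rightarrow>
        {\<tau>. \<sigma> \<subseteq> \<tau> \<and> \<tau> \<subseteq> \<rho> \<and> card \<tau> = m}"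
    proof
      fix \<upsilon> assume \<upsilon>: "\<upsilon> \<in> {\<upsilon>. \<upsilon> \<subseteq> \<rho> - \<sigma> \<and> card \<upsilon> = m - card \<sigma>}"
      then have "finite \<upsilon>" using assms(1) by (auto intro: finite_subset)
      then have "card (\<upsilon> \<union> \<sigma>) = card \<upsilon> + card \<sigma>"
        using fin \<upsilon> by (intro card_Un_disjoint) auto
      then show "\<upsilon> \<union> \<sigma> \<in> {\<tau>. \<sigma> \<subseteq> \<tau> \<and> \<tau> \<subseteq> \<rho> \<and> card \<tau> = m}"
        using \<upsilon> assms by auto
    qed
  qed (use fin in \<open>auto simp: card_Diff_subset\<close>)
  then have "card {\<tau>. \<sigma> \<subseteq> \<tau> \<and> \<tau> \<subseteq> \<rho> \<and> card \<tau> = m}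
    = card {\<upsilon>. \<upsilon> \<subseteq> \<rho> - \<sigma> \<and> card \<upsilon> = m - card \<sigma>}"
    by (rule bij_betw_same_card)
  also have "\<dots> = card (\<rho> - \<sigma>) choose (m - card \<sigma>)"
    using assms(1) by (simp add: n_subsets)
  finally show ?thesis using assms fin by (simp add: card_Diff_subset)
qed

locale weighted_simplicial_complex =
  fixes X :: "'a set set" and d :: int and w :: "'a set \<Rightarrow> real"
  assumes weighted: "weighted_complex X d w"
begin

text \<open>Faces are graded by cardinality, a natural number one larger than the dimension.\<close>

definition sized :: "nat \<Rightarrow> 'a set set" where
  "sized n = {\<sigma> \<in> X. card \<sigma> = n}"

definition N :: nat where "N = nat (d + 1)"

lemma complex: "finite X" "{} \<in> X" "\<sigma> \<in> X \<Longrightarrow> finite \<sigma>" "\<sigma> \<in> X \<Longrightarrow> \<tau> \<subseteq> \<sigma> \<Longrightarrow> \<tau> \<in> X"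
  using weighted by (auto simp: weighted_complex_def pure_complex_def finite_complex_def)

lemma weight_pos: "\<sigma> \<in> X \<Longrightarrow> 0 < w \<sigma>"
  using weighted by (simp add: weighted_complex_def)

lemma finite_sized: "finite (sized n)"
  using complex(1) by (simp add: sized_def)

lemma sizedD: "\<sigma> \<in> sized n \<Longrightarrow> \<sigma> \<in> X" "\<sigma> \<in> sized n \<Longrightarrow> card \<sigma> = n" "\<sigma> \<in> sized n \<Longrightarrow> finite \<sigma>"
  using complex(3) by (auto simp: sized_def)

lemma faces_eq_sized: "faces X (int n - 1) = sized n"
  by (auto simp: faces_def sized_def face_dim_def)

text \<open>Truncation in \<open>N = nat (d + 1)\<close> is harmless: purity applied to the empty
  face produces a face of dimension \<open>d\<close>, so \<open>d\<close> is at least -1.\<close>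

lemma d_eq: "d = int N - 1"
proof -
  obtain \<tau> where "\<tau> \<in> faces X d"
    using weighted complex(2) by (auto simp: weighted_complex_def pure_complex_def)
  then show ?thesis by (auto simp: N_def faces_def face_dim_def)
qed

lemma subset_top: "\<sigma> \<in> X \<Longrightarrow> \<exists>\<tau>\<in>sized N. \<sigma> \<subseteq> \<tau>"
  using weighted unfolding weighted_complex_def pure_complex_def faces_eq_sized[symmetric] d_eq[symmetric]
  by blast

lemma sized_nonempty: "n \<le> N \<Longrightarrow> sized n \<noteq> {}"
proof -
  assume n: "n \<le> N"
  obtain \<tau> where \<tau>: "\<tau> \<in> sized N" using subset_top complex(2) by blast
  then obtain \<sigma> where "\<sigma> \<subseteq> \<tau>" "card \<sigma> = n"
    using n sizedD(2)[OF \<tau>] by (metis obtain_subset_with_card_n)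
  then show ?thesis using \<tau> complex(4) by (auto simp: sized_def)
qed

text \<open>One weighted space for each cardinality: \<open>cochain.V n\<close> and
  \<open>cochain.ip n\<close> are the cochains of dimension \<open>n - 1\<close> and their inner
  product.\<close>

sublocale cochain: weighted_space "sized n" w for n
  by unfold_locales (auto simp: finite_sized weight_pos sizedD)

lemma cochains_eq: "cochains X (int n - 1) = cochain.V n"
  by (simp add: cochains_def vanishing_off_def faces_eq_sized)

lemma cochain_inner_eq: "cochain_inner X w (int n - 1) = wip (sized n) w"
  by (simp add: cochain_inner_def wip_def faces_eq_sized fun_eq_iff)

section \<open>Weighted sums over the faces above a given face\<close>

definition upsum :: "nat \<Rightarrow> ('a set \<Rightarrow> real) \<Rightarrow> 'a set \<Rightarrow> real" where
  "upsum n f \<sigma> = (\<Sum>\<rho> | \<rho> \<in> sized n \<and> \<sigma> \<subseteq> \<rho>. w \<rho> * f \<rho>)"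

text \<open>Double counting: by \<open>card_between\<close>, each \<open>\<rho>\<close> above
  \<open>\<sigma>\<close> is reached through the same number of intermediate \<open>\<tau>\<close>,
  and a \<open>\<rho>\<close> not containing \<open>\<sigma>\<close> is never reached.\<close>

lemma sum_upsum:
  assumes "\<sigma> \<in> sized i" "i \<le> m"
  shows "(\<Sum>\<tau> | \<tau> \<in> sized m \<and> \<sigma> \<subseteq> \<tau>. upsum n f \<tau>) = real ((n - i) choose (m - i)) * upsum n f \<sigma>"
proof -
  let ?A = "{\<tau> \<in> sized m. \<sigma> \<subseteq> \<tau>}"
  have "(\<Sum>\<tau>\<in>?A. upsum n f \<tau>) = (\<Sum>\<rho>\<in>sized n. \<Sum>\<tau> | \<tau> \<in> ?A \<and> \<tau> \<subseteq> \<rho>. w \<rho> * f \<rho>)"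
    unfolding upsum_def by (rule sum.swap_restrict) (simp_all add: finite_sized)
  also have "\<dots> = (\<Sum>\<rho>\<in>sized n. if \<sigma> \<subseteq> \<rho> then real ((n - i) choose (m - i)) * (w \<rho> * f \<rho>) else 0)"
  proof (intro sum.cong refl)
    fix \<rho> assume \<rho>: "\<rho> \<in> sized n"
    show "(\<Sum>\<tau> | \<tau> \<in> ?A \<and> \<tau> \<subseteq> \<rho>. w \<rho> * f \<rho>)
      = (if \<sigma> \<subseteq> \<rho> then real ((n - i) choose (m - i)) * (w \<rho> * f \<rho>) else 0)"
    proof (cases "\<sigma> \<subseteq> \<rho>")
      case True
      have "{\<tau> \<in> ?A. \<tau> \<subseteq> \<rho>} = {\<tau>. \<sigma> \<subseteq> \<tau> \<and> \<tau> \<subseteq> \<rho> \<and> card \<tau> = m}"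
        using \<rho> complex(4) by (auto simp: sized_def)
      then have "card {\<tau> \<in> ?A. \<tau> \<subseteq> \<rho>} = (n - i) choose (m - i)"
        using card_between[of \<rho> \<sigma> m] True assms \<rho> by (simp add: sizedD)
      then show ?thesis using True by simp
    next
      case False
      then have "{\<tau> \<in> ?A. \<tau> \<subseteq> \<rho>} = {}" by auto
      then show ?thesis by (simp only: False sum.empty if_False)
    qed
  qed
  also have "\<dots> = (\<Sum>\<rho> | \<rho> \<in> sized n \<and> \<sigma> \<subseteq> \<rho>. real ((n - i) choose (m - i)) * (w \<rho> * f \<rho>))"
    using finite_sized by (simp add: sum.inter_filter)
  finally show ?thesis by (simp add: upsum_def sum_distrib_left)
qed

text \<open>For \<open>n < N\<close> this is the defining equation of the weights, cleared of its
  denominator. For \<open>n = N\<close> the only top face above \<open>\<sigma>\<close> is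
  \<open>\<sigma>\<close> itself.\<close>

lemma top_upsum:
  assumes "\<sigma> \<in> sized n"
  shows "upsum N (\<lambda>_. 1) \<sigma> = real (N choose n) * w \<sigma>"
proof -
  obtain \<tau> where \<tau>: "\<tau> \<in> sized N" "\<sigma> \<subseteq> \<tau>"
    using subset_top assms sizedD by blast
  show ?thesis
  proof (cases "n < N")
    case True
    have "w \<sigma> = (\<Sum>\<tau> | \<tau> \<in> faces X d \<and> \<sigma> \<subseteq> \<tau>. w \<tau>) / real (nat (d + 1) choose nat (int n - 1 + 1))"
    proof -
      have "\<forall>i<d. \<forall>\<tau>\<in>faces X i. w \<tau>
        = (\<Sum>\<sigma> | \<sigma> \<in> faces X d \<and> \<tau> \<subseteq> \<sigma>. w \<sigma>) / real (nat (d + 1) choose nat (i + 1))"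
        using weighted unfolding weighted_complex_def by blast
      moreover have "int n - 1 < d" "\<sigma> \<in> faces X (int n - 1)"
        using True d_eq assms faces_eq_sized[of n] by auto
      ultimately show ?thesis by blast
    qed
    moreover have "faces X d = sized N" "nat (d + 1) = N" "nat (int n - 1 + 1) = n"
      using faces_eq_sized[of N] d_eq by auto
    ultimately have "w \<sigma> = upsum N (\<lambda>_. 1) \<sigma> / real (N choose n)"
      by (simp only: upsum_def mult_1_right)
    moreover have "N choose n \<noteq> 0" using True by simp
    ultimately show ?thesis by (metis nonzero_mult_div_cancel_left of_nat_eq_0_iff times_divide_eq_right)
  next
    case False
    have nN: "n = N" and "\<sigma> = \<tau>"
      using False \<tau> assms sizedD card_subset_eq[of \<tau> \<sigma>] card_mono[of \<tau> \<sigma>] by force+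
    have "{\<rho> \<in> sized N. \<sigma> \<subseteq> \<rho>} = {\<sigma>}"
    proof -
      have "\<rho> = \<sigma>" if "\<rho> \<in> sized N" "\<sigma> \<subseteq> \<rho>" for \<rho>
        using that assms nN sizedD[OF that(1)] sizedD[OF assms] card_subset_eq by metis
      then show ?thesis using assms nN by auto
    qed
    then show ?thesis by (simp add: upsum_def nN)
  qed
qed

text \<open>Express all weights through top faces with \<open>top_upsum\<close> and count with
  \<open>sum_upsum\<close>; the binomials cancel by the absorption identities. This consistency of
  weights between adjacent dimensions makes the walks stochastic.\<close>

lemma upsum_Suc_one:
  assumes "\<sigma> \<in> sized n" "n < N"
  shows "upsum (Suc n) (\<lambda>_. 1) \<sigma> = real (Suc n) * w \<sigma>"
proof -
  have "real (N choose Suc n) * upsum (Suc n) (\<lambda>_. 1) \<sigma>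
    = (\<Sum>\<tau> | \<tau> \<in> sized (Suc n) \<and> \<sigma> \<subseteq> \<tau>. upsum N (\<lambda>_. 1) \<tau>)"
    unfolding upsum_def[of "Suc n"] sum_distrib_left by (intro sum.cong refl) (simp add: top_upsum[of _ "Suc n"])
  also have "\<dots> = real ((N - n) * (N choose n)) * w \<sigma>"
    using sum_upsum[OF assms(1), of "Suc n" N "\<lambda>_. 1"] assms by (simp add: top_upsum Suc_diff_le)
  also have "(N - n) * (N choose n) = Suc n * (N choose Suc n)"
    by (metis binomial_absorb_comp binomial_absorption)
  finally have "real (N choose Suc n) * upsum (Suc n) (\<lambda>_. 1) \<sigma>
    = real (N choose Suc n) * (real (Suc n) * w \<sigma>)"
    by (simp add: algebra_simps)
  moreover have "N choose Suc n \<noteq> 0" using assms(2) by simp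
  ultimately show ?thesis by (metis mult_cancel_left of_nat_eq_0_iff)
qed

section \<open>The averaging operators and the quadratic form of the non-lazy walk\<close>

definition down :: "nat \<Rightarrow> ('a set \<Rightarrow> real) \<Rightarrow> 'a set \<Rightarrow> real" where
  "down n f \<sigma> = (if \<sigma> \<in> sized n then upsum (Suc n) f \<sigma> / (real (Suc n) * w \<sigma>) else 0)"

text \<open>Both operators are indexed by the cardinality of the smaller faces:
  \<open>down n\<close> lands in functions on \<open>sized n\<close>, while \<open>up n\<close>
  starts there.\<close>

definition up :: "nat \<Rightarrow> ('a set \<Rightarrow> real) \<Rightarrow> 'a set \<Rightarrow> real" where
  "up n f \<rho> = (if \<rho> \<in> sized (Suc n) then (\<Sum>\<sigma> | \<sigma> \<in> sized n \<and> \<sigma> \<subseteq> \<rho>. f \<sigma>) / real (Suc n) else 0)"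

text \<open>Both sides are the same sum over incident pairs, in which a pair carries the weight
  \<open>w \<rho> / real (Suc n)\<close>.\<close>

lemma down_adjoint: "cochain.ip n (down n f) g = cochain.ip (Suc n) f (up n g)"
proof -
  have "cochain.ip n (down n f) g
    = (\<Sum>\<sigma>\<in>sized n. \<Sum>\<rho> | \<rho> \<in> sized (Suc n) \<and> \<sigma> \<subseteq> \<rho>. w \<rho> * f \<rho> * g \<sigma> / real (Suc n))"
    unfolding wip_def
  proof (intro sum.cong refl)
    fix \<sigma> assume \<sigma>: "\<sigma> \<in> sized n"
    then have "w \<sigma> \<noteq> 0" using weight_pos sizedD by force
    then have "w \<sigma> * down n f \<sigma> = upsum (Suc n) f \<sigma> / real (Suc n)"
      using \<sigma> by (simp add: down_def del: of_nat_Suc)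
    then show "w \<sigma> * down n f \<sigma> * g \<sigma>
      = (\<Sum>\<rho> | \<rho> \<in> sized (Suc n) \<and> \<sigma> \<subseteq> \<rho>. w \<rho> * f \<rho> * g \<sigma> / real (Suc n))"
      by (simp add: upsum_def sum_distrib_right sum_divide_distrib)
  qed
  also have "\<dots> = (\<Sum>\<rho>\<in>sized (Suc n). \<Sum>\<sigma> | \<sigma> \<in> sized n \<and> \<sigma> \<subseteq> \<rho>. w \<rho> * f \<rho> * g \<sigma> / real (Suc n))"
    by (rule sum.swap_restrict) (simp_all add: finite_sized)
  also have "\<dots> = cochain.ip (Suc n) f (up n g)"
    by (simp add: wip_def up_def sum_distrib_left sum_divide_distrib)
  finally show ?thesis .
qed

lemma upsum_add: "upsum n (f + g) \<sigma> = upsum n f \<sigma> + upsum n g \<sigma>"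
  by (simp add: upsum_def algebra_simps sum.distrib)

lemma upsum_scale: "upsum n (\<lambda>x. c * f x) \<sigma> = c * upsum n f \<sigma>"
  by (simp add: upsum_def sum_distrib_left mult_ac)

lemma upsum_sum: "upsum n (sum f A) \<sigma> = (\<Sum>i\<in>A. upsum n (f i) \<sigma>)"
proof -
  have "upsum n (sum f A) \<sigma> = (\<Sum>\<rho> | \<rho> \<in> sized n \<and> \<sigma> \<subseteq> \<rho>. \<Sum>i\<in>A. w \<rho> * f i \<rho>)"
    by (simp add: upsum_def sum_fun_apply sum_distrib_left)
  then show ?thesis by (simp add: upsum_def sum.swap[of _ A])
qed

lemma down_sum: "down n (sum f A) = (\<Sum>i\<in>A. down n (f i))"
  by (rule ext) (simp add: down_def sum_fun_apply upsum_sum sum_divide_distrib)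

lemma down_in_V: "down n f \<in> cochain.V n"
  by (simp add: down_def vanishing_off_def)

text \<open>The form of the non-lazy walk without denominators. It also makes sense for
  \<open>n = 0\<close>, where it vanishes and starts the induction, while
  \<open>nonlazy_walk\<close> would divide by 0 there.\<close>

definition walk_form :: "nat \<Rightarrow> ('a set \<Rightarrow> real) \<Rightarrow> real" where
  "walk_form n f = (\<Sum>\<sigma>\<in>sized n. \<Sum>\<tau> | \<tau> \<in> sized n \<and> \<sigma> \<union> \<tau> \<in> sized (Suc n).
     w (\<sigma> \<union> \<tau>) * f \<sigma> * f \<tau>)"

text \<open>The factor \<open>n\<close> is the \<open>k + 1\<close> in the walk, and
  \<open>Suc n\<close> comes from the normalization of vertex weights in the link of
  \<open>\<sigma>\<close>.\<close>

lemma walk_form_eq: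
  assumes "0 < n"
  shows "walk_form n f
    = real n * real (Suc n) * cochain.ip n (nonlazy_walk X w (int n - 1) f) f"
proof -
  have card: "card (\<tau> - \<sigma>) = 1" if "\<sigma> \<in> sized n" "\<tau> \<in> sized n" "\<sigma> \<union> \<tau> \<in> sized (Suc n)" for \<sigma> \<tau>
  proof -
    have "\<tau> - \<sigma> = (\<sigma> \<union> \<tau>) - \<sigma>" by blast
    then have "card (\<tau> - \<sigma>) = card (\<sigma> \<union> \<tau>) - card \<sigma>"
      using that sizedD by (metis card_Diff_subset Un_upper1)
    then show ?thesis using that sizedD(2) by force
  qed
  have "walk_form n f = (\<Sum>\<sigma>\<in>sized n. real n * real (Suc n) *
      (w \<sigma> * nonlazy_walk X w (int n - 1) f \<sigma> * f \<sigma>))"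
    unfolding walk_form_def
  proof (intro sum.cong refl)
    fix \<sigma> assume \<sigma>: "\<sigma> \<in> sized n"
    then have w: "w \<sigma> \<noteq> 0" using weight_pos sizedD by force
    have "nonlazy_walk X w (int n - 1) f \<sigma> = (\<Sum>\<tau> | \<tau> \<in> sized n \<and> \<sigma> \<union> \<tau> \<in> sized (Suc n).
        link_weight w \<sigma> (\<tau> - \<sigma>) * f \<tau>) / real n"
      using \<sigma> faces_eq_sized[of n] faces_eq_sized[of "Suc n"] by (simp add: nonlazy_walk_def)
    also have "(\<Sum>\<tau> | \<tau> \<in> sized n \<and> \<sigma> \<union> \<tau> \<in> sized (Suc n). link_weight w \<sigma> (\<tau> - \<sigma>) * f \<tau>)
      = (\<Sum>\<tau> | \<tau> \<in> sized n \<and> \<sigma> \<union> \<tau> \<in> sized (Suc n). w (\<sigma> \<union> \<tau>) * f \<tau>) / (real (Suc n) * w \<sigma>)"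
      unfolding sum_divide_distrib
      using card[OF \<sigma>] \<sigma> by (intro sum.cong refl) (auto simp: link_weight_def sizedD Un_commute)
    finally have "real n * real (Suc n) * w \<sigma> * nonlazy_walk X w (int n - 1) f \<sigma>
      = (\<Sum>\<tau> | \<tau> \<in> sized n \<and> \<sigma> \<union> \<tau> \<in> sized (Suc n). w (\<sigma> \<union> \<tau>) * f \<tau>)"
      using assms w by simp
    then have "real n * real (Suc n) * (w \<sigma> * nonlazy_walk X w (int n - 1) f \<sigma> * f \<sigma>)
      = (\<Sum>\<tau> | \<tau> \<in> sized n \<and> \<sigma> \<union> \<tau> \<in> sized (Suc n). w (\<sigma> \<union> \<tau>) * f \<tau>) * f \<sigma>"
      by (simp only: mult.assoc[symmetric])
    then show "(\<Sum>\<tau> | \<tau> \<in> sized n \<and> \<sigma> \<union> \<tau> \<in> sized (Suc n). w (\<sigma> \<union> \<tau>) * f \<sigma> * f \<tau>)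
      = real n * real (Suc n) * (w \<sigma> * nonlazy_walk X w (int n - 1) f \<sigma> * f \<sigma>)"
      by (simp only: sum_distrib_left mult_ac)
  qed
  then show ?thesis by (simp add: wip_def sum_distrib_left)
qed

text \<open>Expand the square at each \<open>\<rho>\<close> into pairs of its facets. Equal facets
  are collected by \<open>upsum_Suc_one\<close>; two distinct facets determine \<open>\<rho>\<close>
  as their union and give the terms of \<open>walk_form\<close>.\<close>

lemma up_norm:
  assumes "n < N"
  shows "(real (Suc n))\<^sup>2 * cochain.ip (Suc n) (up n f) (up n f)
    = real (Suc n) * cochain.ip n f f + walk_form n f"
proof -
  let ?B = "\<lambda>\<rho>. {\<sigma>. \<sigma> \<in> sized n \<and> \<sigma> \<subseteq> \<rho>}"
  have "(real (Suc n))\<^sup>2 * cochain.ip (Suc n) (up n f) (up n f)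
    = (\<Sum>\<rho>\<in>sized (Suc n). w \<rho> * (\<Sum>\<sigma>\<in>?B \<rho>. f \<sigma>)\<^sup>2)"
    unfolding wip_def sum_distrib_left
  proof (intro sum.cong refl)
    fix \<rho> assume "\<rho> \<in> sized (Suc n)"
    then have "(\<Sum>\<sigma>\<in>?B \<rho>. f \<sigma>) = real (Suc n) * up n f \<rho>" by (simp add: up_def)
    then show "(real (Suc n))\<^sup>2 * (w \<rho> * up n f \<rho> * up n f \<rho>) = w \<rho> * (\<Sum>\<sigma>\<in>?B \<rho>. f \<sigma>)\<^sup>2"
      by (simp only: power2_eq_square mult_ac)
  qed
  also have "\<dots> = (\<Sum>\<rho>\<in>sized (Suc n). \<Sum>\<sigma>\<in>?B \<rho>. \<Sum>\<tau>\<in>?B \<rho>. w \<rho> * f \<sigma> * f \<tau>)"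
    by (simp add: power2_eq_square sum_product sum_distrib_left mult_ac)
  also have "\<dots> = (\<Sum>\<sigma>\<in>sized n. \<Sum>\<rho> | \<rho> \<in> sized (Suc n) \<and> \<sigma> \<subseteq> \<rho>. \<Sum>\<tau>\<in>?B \<rho>. w \<rho> * f \<sigma> * f \<tau>)"
    by (rule sum.swap_restrict) (simp_all add: finite_sized)
  also have "\<dots> = (\<Sum>\<sigma>\<in>sized n. \<Sum>\<tau>\<in>sized n. \<Sum>\<rho> | \<rho> \<in> {\<rho> \<in> sized (Suc n). \<sigma> \<subseteq> \<rho>} \<and> \<tau> \<subseteq> \<rho>.
      w \<rho> * f \<sigma> * f \<tau>)"
    by (intro sum.cong refl sum.swap_restrict) (simp_all add: finite_sized)
  also have "\<dots> = (\<Sum>\<sigma>\<in>sized n. \<Sum>\<tau>\<in>sized n. (if \<tau> = \<sigma> then real (Suc n) * (w \<sigma> * f \<sigma> * f \<sigma>) else 0)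
      + (if \<sigma> \<union> \<tau> \<in> sized (Suc n) then w (\<sigma> \<union> \<tau>) * f \<sigma> * f \<tau> else 0))"
  proof (intro sum.cong refl)
    fix \<sigma> \<tau> assume \<sigma>: "\<sigma> \<in> sized n" and \<tau>: "\<tau> \<in> sized n"
    let ?C = "{\<rho>. \<rho> \<in> {\<rho> \<in> sized (Suc n). \<sigma> \<subseteq> \<rho>} \<and> \<tau> \<subseteq> \<rho>}"
    have sum: "(\<Sum>\<rho>\<in>?C. w \<rho> * f \<sigma> * f \<tau>) = (\<Sum>\<rho>\<in>?C. w \<rho>) * f \<sigma> * f \<tau>"
      by (simp add: sum_distrib_right)
    show "(\<Sum>\<rho>\<in>?C. w \<rho> * f \<sigma> * f \<tau>) = (if \<tau> = \<sigma> then real (Suc n) * (w \<sigma> * f \<sigma> * f \<sigma>) else 0)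
      + (if \<sigma> \<union> \<tau> \<in> sized (Suc n) then w (\<sigma> \<union> \<tau>) * f \<sigma> * f \<tau> else 0)"
    proof (cases "\<tau> = \<sigma>")
      case True
      then have "(\<Sum>\<rho>\<in>?C. w \<rho>) = real (Suc n) * w \<sigma>"
        using upsum_Suc_one[OF \<sigma> assms] by (simp add: upsum_def)
      then show ?thesis using True \<sigma> unfolding sum by (simp add: sized_def)
    next
      case False
      have C: "\<rho> = \<sigma> \<union> \<tau>" if "\<rho> \<in> ?C" for \<rho>
      proof -
        have "\<not> \<tau> \<subseteq> \<sigma>" using False card_subset_eq[of \<sigma> \<tau>] \<sigma> \<tau> sizedD by metis
        then have "card \<sigma> < card (\<sigma> \<union> \<tau>)"
          using \<sigma> \<tau> sizedD(3) by (intro psubset_card_mono) auto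
        moreover have "finite \<rho>" "card \<rho> = Suc n" "\<sigma> \<union> \<tau> \<subseteq> \<rho>" using that sizedD by auto
        ultimately show ?thesis
          using card_seteq[of \<rho> "\<sigma> \<union> \<tau>"] \<sigma> sizedD(2) by fastforce
      qed
      have "?C = (if \<sigma> \<union> \<tau> \<in> sized (Suc n) then {\<sigma> \<union> \<tau>} else {})"
        using C by auto
      then show ?thesis using False unfolding sum by simp
    qed
  qed
  also have "\<dots> = (\<Sum>\<sigma>\<in>sized n. real (Suc n) * (w \<sigma> * f \<sigma> * f \<sigma>) +
      (\<Sum>\<tau> | \<tau> \<in> sized n \<and> \<sigma> \<union> \<tau> \<in> sized (Suc n). w (\<sigma> \<union> \<tau>) * f \<sigma> * f \<tau>))"
    by (intro sum.cong refl) (simp add: sum.distrib finite_sized sum.inter_filter)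
  finally show ?thesis
    by (simp only: sum.distrib walk_form_def wip_def sum_distrib_left)
qed

subsection \<open>Links\<close>

lemma link_faces_iff:
  assumes "\<sigma> \<in> X"
  shows "\<tau> \<in> faces (link X \<sigma>) (int m - 1) \<longleftrightarrow> \<tau> \<inter> \<sigma> = {} \<and> \<tau> \<union> \<sigma> \<in> X \<and> card \<tau> = m"
proof -
  have "\<tau> \<in> link X \<sigma> \<longleftrightarrow> \<tau> \<inter> \<sigma> = {} \<and> \<tau> \<union> \<sigma> \<in> X"
  proof
    assume "\<tau> \<in> link X \<sigma>"
    then obtain \<rho> where "\<rho> \<in> X" "\<sigma> \<subseteq> \<rho>" "\<tau> = \<rho> - \<sigma>" by (auto simp: link_def)
    then show "\<tau> \<inter> \<sigma> = {} \<and> \<tau> \<union> \<sigma> \<in> X" by (auto simp: Un_absorb2)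
  next
    assume "\<tau> \<inter> \<sigma> = {} \<and> \<tau> \<union> \<sigma> \<in> X"
    then show "\<tau> \<in> link X \<sigma>"
      unfolding link_def by (intro CollectI exI[of _ "\<tau> \<union> \<sigma>"]) auto
  qed
  then show ?thesis by (auto simp: faces_def face_dim_def)
qed

lemma card_link_face:
  assumes "\<tau> \<inter> \<sigma> = {}" "\<tau> \<union> \<sigma> \<in> X"
  shows "card (\<tau> \<union> \<sigma>) = card \<tau> + card \<sigma>"
  using assms complex(3) by (intro card_Un_disjoint) auto

lemma sum_link_faces:
  assumes "\<sigma> \<in> sized s"
  shows "(\<Sum>\<tau>\<in>faces (link X \<sigma>) (int m - 1). h \<tau>)
    = (\<Sum>\<rho> | \<rho> \<in> sized (s + m) \<and> \<sigma> \<subseteq> \<rho>. h (\<rho> - \<sigma>))"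
proof (rule sum.reindex_bij_witness[where i = "\<lambda>\<rho>. \<rho> - \<sigma>" and j = "\<lambda>\<tau>. \<tau> \<union> \<sigma>"])
  fix \<tau> assume "\<tau> \<in> faces (link X \<sigma>) (int m - 1)"
  then have \<tau>: "\<tau> \<inter> \<sigma> = {}" "\<tau> \<union> \<sigma> \<in> X" "card \<tau> = m"
    using link_faces_iff assms sizedD by blast+
  show "\<tau> \<union> \<sigma> - \<sigma> = \<tau>" using \<tau>(1) by blast
  then show "h (\<tau> \<union> \<sigma> - \<sigma>) = h \<tau>" by simp
  show "\<tau> \<union> \<sigma> \<in> {\<rho>. \<rho> \<in> sized (s + m) \<and> \<sigma> \<subseteq> \<rho>}"
    using \<tau> card_link_face[of \<tau> \<sigma>] sizedD(2)[OF assms] by (auto simp: sized_def)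
next
  fix \<rho> assume \<rho>: "\<rho> \<in> {\<rho>. \<rho> \<in> sized (s + m) \<and> \<sigma> \<subseteq> \<rho>}"
  then show eq: "\<rho> - \<sigma> \<union> \<sigma> = \<rho>" by blast
  have "\<rho> - \<sigma> \<union> \<sigma> \<in> X" "(\<rho> - \<sigma>) \<inter> \<sigma> = {}"
    using eq \<rho> by (simp_all add: sized_def Int_commute)
  moreover have "card (\<rho> - \<sigma>) = m"
    using \<rho> sizedD(2,3)[OF assms] by (simp add: card_Diff_subset sized_def)
  ultimately show "\<rho> - \<sigma> \<in> faces (link X \<sigma>) (int m - 1)"
    unfolding link_faces_iff[OF sizedD(1)[OF assms]] by blast
qed

text \<open>The link inner product with the constant function is \<open>upsum n f \<sigma>\<close>
  up to a nonzero normalization. The tested faces have dimension \<open>i - 1\<close>, that is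
  cardinality \<open>i\<close>.\<close>

lemma level_iff:
  assumes "i \<le> n"
  shows "level X w (int n - 1) (int i) f \<longleftrightarrow> f \<in> cochain.V n \<and> (\<forall>\<sigma>\<in>sized i. upsum n f \<sigma> = 0)"
proof -
  have "cochain_inner (link X \<sigma>) (link_weight w \<sigma>) (int n - 1 - int i)
      (localize X (int n - 1) f \<sigma>) (one_cochain (link X \<sigma>) (int n - 1 - int i)) = 0
    \<longleftrightarrow> upsum n f \<sigma> = 0" if \<sigma>: "\<sigma> \<in> sized i" for \<sigma>
  proof -
    let ?F = "faces (link X \<sigma>) (int (n - i) - 1)"
    have dim: "int n - 1 - int i = int (n - i) - 1" "int n - 1 - face_dim \<sigma> - 1 = int (n - i) - 1"
      using assms sizedD(2)[OF \<sigma>] by (auto simp: face_dim_def)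
    define c where "c = real (n choose i) * w \<sigma>"
    have c: "c \<noteq> 0"
      using assms weight_pos[OF sizedD(1)[OF \<sigma>]] by (simp add: c_def)
    have "cochain_inner (link X \<sigma>) (link_weight w \<sigma>) (int n - 1 - int i)
      (localize X (int n - 1) f \<sigma>) (one_cochain (link X \<sigma>) (int n - 1 - int i))
      = (\<Sum>\<tau>\<in>?F. w (\<tau> \<union> \<sigma>) * f (\<tau> \<union> \<sigma>) / c)"
      unfolding cochain_inner_def localize_def one_cochain_def dim
    proof (intro sum.cong refl)
      fix \<tau> assume \<tau>: "\<tau> \<in> ?F"
      then have "card \<tau> = n - i" using link_faces_iff \<sigma> sizedD(1) by blast
      then show "link_weight w \<sigma> \<tau> * (if \<tau> \<in> ?F then f (\<sigma> \<union> \<tau>) else 0) * indicator ?F \<tau>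
        = w (\<tau> \<union> \<sigma>) * f (\<tau> \<union> \<sigma>) / c"
        using \<tau> assms sizedD(2)[OF \<sigma>] by (simp add: link_weight_def c_def Un_commute)
    qed
    also have "\<dots> = (\<Sum>\<rho> | \<rho> \<in> sized n \<and> \<sigma> \<subseteq> \<rho>. w \<rho> * f \<rho> / c)"
      unfolding sum_link_faces[OF \<sigma>] using assms by (intro sum.cong) (auto simp: Un_absorb2)
    also have "\<dots> = upsum n f \<sigma> / c"
      by (simp add: upsum_def sum_divide_distrib)
    finally show ?thesis using c by simp
  qed
  then show ?thesis
    unfolding level_def cochains_eq faces_eq_sized by blast
qed

definition link_vertices :: "'a set \<Rightarrow> 'a set set" where
  "link_vertices \<sigma> = faces (link X \<sigma>) 0"

text \<open>Transition kernel of the non-lazy walk on the vertices of the link, with vertices kept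
  as singleton sets. The nested \<open>link_weight\<close> is a weight in the link of
  \<open>x\<close> taken inside the link of \<open>\<sigma>\<close>.\<close>

definition link_kernel :: "'a set \<Rightarrow> 'a set \<Rightarrow> 'a set \<Rightarrow> real" where
  "link_kernel \<sigma> x y = (if x \<union> y \<in> faces (link X \<sigma>) 1
     then link_weight (link_weight w \<sigma>) x (y - x) else 0)"

lemma link_vertices_iff:
  "\<sigma> \<in> X \<Longrightarrow> x \<in> link_vertices \<sigma> \<longleftrightarrow> x \<inter> \<sigma> = {} \<and> x \<union> \<sigma> \<in> X \<and> card x = 1"
  using link_faces_iff[of \<sigma> x 1] by (simp add: link_vertices_def)

lemma link_edges_iff:
  "\<sigma> \<in> X \<Longrightarrow> e \<in> faces (link X \<sigma>) 1 \<longleftrightarrow> e \<inter> \<sigma> = {} \<and> e \<union> \<sigma> \<in> X \<and> card e = 2"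
  using link_faces_iff[of \<sigma> e 2] by simp

lemma link_weight_vertex:
  "card \<sigma> = s \<Longrightarrow> card x = 1 \<Longrightarrow> link_weight w \<sigma> x = w (x \<union> \<sigma>) / (real (Suc s) * w \<sigma>)"
  by (simp add: link_weight_def)

text \<open>The two normalizations collapse: the link of \<open>x\<close> inside the link of
  \<open>\<sigma>\<close> has the weights of the link of \<open>x \<union> \<sigma>\<close> in
  \<open>X\<close>.\<close>

lemma link_kernel_eq:
  assumes \<sigma>: "\<sigma> \<in> sized s" and x: "x \<in> link_vertices \<sigma>" and y: "y \<in> link_vertices \<sigma>"
  shows "link_kernel \<sigma> x y = (if x \<union> y \<union> \<sigma> \<in> sized (s + 2)
    then w (x \<union> y \<union> \<sigma>) / (real (s + 2) * w (x \<union> \<sigma>)) else 0)"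
proof -
  have \<sigma>X: "\<sigma> \<in> X" "card \<sigma> = s" using \<sigma> sizedD by auto
  note X = link_vertices_iff[OF \<sigma>X(1)]
  have fin: "finite x" "finite y" using x y X card.infinite by fastforce+
  have disj: "(x \<union> y) \<inter> \<sigma> = {}" using x y X by auto
  have edge: "x \<union> y \<in> faces (link X \<sigma>) 1 \<longleftrightarrow> x \<union> y \<union> \<sigma> \<in> sized (s + 2)"
    using link_edges_iff[OF \<sigma>X(1)] card_link_face[OF disj] disj \<sigma>X by (auto simp: sized_def)
  show ?thesis
  proof (cases "x \<union> y \<union> \<sigma> \<in> sized (s + 2)")
    case True
    then have c2: "card (x \<union> y) = 2" using edge link_edges_iff[OF \<sigma>X(1)] by blast
    have "card (y - x) = card (x \<union> y) - card x"
      using fin by (metis Diff_cancel Un_Diff Un_upper1 card_Diff_subset sup_bot.left_neutral)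
    then have cyx: "card (y - x) = 1" "card x = 1" using c2 x X by auto
    \<comment> \<open>The binomial normalizes the edge weight in the link of
      \<open>\<sigma>\<close>; the 2 normalizes the second localization, at the vertex
      \<open>x\<close>.\<close>
    have "2 * ((s + 2) choose s) = Suc s * (s + 2)"
      using binomial_absorption[of 1 "s + 2"] binomial_symmetric[of s "s + 2"]
      by (simp add: numeral_2_eq_2 algebra_simps del: binomial_Suc_Suc)
    then have "2 * real ((s + 2) choose s) = real (Suc s) * real (s + 2)"
      by (metis of_nat_mult of_nat_numeral)
    then have choose: "real ((s + 2) choose s) = real (Suc s) * real (s + 2) / 2" by simp
    have pos: "w \<sigma> > 0" "w (x \<union> \<sigma>) > 0" using weight_pos x X \<sigma>X by auto
    have "link_weight w \<sigma> (y - x \<union> x) = w (x \<union> y \<union> \<sigma>) / (real ((s + 2) choose s) * w \<sigma>)"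
      using c2 \<sigma>X by (simp add: link_weight_def Un_commute)
    then have "link_weight (link_weight w \<sigma>) x (y - x) = w (x \<union> y \<union> \<sigma>) / (real ((s + 2) choose s) * w \<sigma>)
      / (2 * (w (x \<union> \<sigma>) / (real (Suc s) * w \<sigma>)))"
      unfolding link_weight_def[of "link_weight w \<sigma>"] link_weight_vertex[OF \<sigma>X(2) cyx(2)]
      using cyx by (simp add: numeral_2_eq_2)
    also have "\<dots> = w (x \<union> y \<union> \<sigma>) / (real (s + 2) * w (x \<union> \<sigma>))"
      unfolding choose using pos by (simp add: field_simps del: of_nat_Suc of_nat_add)
    finally show ?thesis using True edge by (simp add: link_kernel_def)
  qed (simp add: link_kernel_def edge)
qed

text \<open>Rows sum to 1 by \<open>upsum_Suc_one\<close> at the face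
  \<open>x \<union> \<sigma>\<close>, which uses \<open>s + 2 \<le> N\<close>. Reversibility holds
  because the vertex weight cancels, leaving an expression symmetric in the two vertices.\<close>

lemma link_reversible_kernel:
  assumes \<sigma>: "\<sigma> \<in> sized s" and s: "s + 2 \<le> N"
  shows "reversible_kernel (link_vertices \<sigma>) (link_weight w \<sigma>) (link_kernel \<sigma>)"
proof
  have \<sigma>X: "\<sigma> \<in> X" "card \<sigma> = s" using \<sigma> sizedD by auto
  note X = link_vertices_iff[OF \<sigma>X(1)]
  show "finite (link_vertices \<sigma>)"
  proof -
    have "link_vertices \<sigma> \<subseteq> X" using X complex(4) by blast
    then show ?thesis using complex(1) finite_subset by blast
  qed
  have pos: "w \<sigma> > 0" "\<And>x. x \<in> link_vertices \<sigma> \<Longrightarrow> w (x \<union> \<sigma>) > 0" using weight_pos X \<sigma>X by auto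
  fix x assume x: "x \<in> link_vertices \<sigma>"
  then show "0 < link_weight w \<sigma> x"
    using pos X \<sigma>X by (simp add: link_weight_vertex)
  have x\<sigma>: "x \<union> \<sigma> \<in> sized (Suc s)"
    using x X card_link_face[of x \<sigma>] \<sigma>X by (simp add: sized_def)
  show "(\<Sum>y\<in>link_vertices \<sigma>. link_kernel \<sigma> x y) = 1"
  proof -
    let ?c = "real (s + 2) * w (x \<union> \<sigma>)"
    have "(\<Sum>y\<in>link_vertices \<sigma>. link_kernel \<sigma> x y)
      = (\<Sum>y\<in>{y \<in> link_vertices \<sigma>. x \<union> y \<union> \<sigma> \<in> sized (s + 2)}. w (x \<union> y \<union> \<sigma>) / ?c)"
      using \<open>finite (link_vertices \<sigma>)\<close> by (simp add: sum.inter_filter link_kernel_eq[OF \<sigma> x] cong: if_cong)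
    also have "\<dots> = (\<Sum>\<rho>\<in>{\<rho> \<in> sized (s + 2). x \<union> \<sigma> \<subseteq> \<rho>}. w \<rho> / ?c)"
    proof (rule sum.reindex_bij_witness[where i = "\<lambda>\<rho>. \<rho> - (x \<union> \<sigma>)" and j = "\<lambda>y. x \<union> y \<union> \<sigma>"])
      fix y assume y: "y \<in> {y \<in> link_vertices \<sigma>. x \<union> y \<union> \<sigma> \<in> sized (s + 2)}"
      then have "x \<noteq> y" using x\<sigma> by (auto simp: sized_def)
      then have "x \<inter> y = {}"
        using x y X by (auto simp: card_1_singleton_iff)
      then show "x \<union> y \<union> \<sigma> - (x \<union> \<sigma>) = y" using y X by auto
      show "x \<union> y \<union> \<sigma> \<in> {\<rho> \<in> sized (s + 2). x \<union> \<sigma> \<subseteq> \<rho>}" using y by auto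
    next
      fix \<rho> assume \<rho>: "\<rho> \<in> {\<rho> \<in> sized (s + 2). x \<union> \<sigma> \<subseteq> \<rho>}"
      then show eq: "x \<union> (\<rho> - (x \<union> \<sigma>)) \<union> \<sigma> = \<rho>" by auto
      have "card (\<rho> - (x \<union> \<sigma>)) = 1"
        using \<rho> sizedD(2,3)[OF x\<sigma>] by (auto simp: card_Diff_subset sized_def)
      moreover have "\<rho> - (x \<union> \<sigma>) \<union> \<sigma> \<in> X"
        using \<rho> complex(4)[of \<rho> "\<rho> - (x \<union> \<sigma>) \<union> \<sigma>"] sizedD(1) by blast
      ultimately have "\<rho> - (x \<union> \<sigma>) \<in> link_vertices \<sigma>"
        using X by auto
      then show "\<rho> - (x \<union> \<sigma>) \<in> {y \<in> link_vertices \<sigma>. x \<union> y \<union> \<sigma> \<in> sized (s + 2)}"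
        using eq \<rho> by simp
    qed auto
    also have "\<dots> = upsum (s + 2) (\<lambda>_. 1) (x \<union> \<sigma>) / ?c"
      by (simp add: upsum_def sum_divide_distrib)
    also have "\<dots> = 1"
      using upsum_Suc_one[OF x\<sigma>] s pos(2)[OF x] by simp
    finally show ?thesis .
  qed
  fix y assume y: "y \<in> link_vertices \<sigma>"
  show "0 \<le> link_kernel \<sigma> x y"
    using pos(2)[OF x] weight_pos sizedD(1) by (simp add: link_kernel_eq[OF \<sigma> x y] less_imp_le)
  have "link_weight w \<sigma> a * link_kernel \<sigma> a b = (if a \<union> b \<union> \<sigma> \<in> sized (s + 2)
    then w (a \<union> b \<union> \<sigma>) / (real (s + 2) * (real (Suc s) * w \<sigma>)) else 0)"
    if "a \<in> link_vertices \<sigma>" "b \<in> link_vertices \<sigma>" for a b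
    using pos(1) pos(2)[OF that(1)] that(1) X \<sigma>X
    by (simp add: link_kernel_eq[OF \<sigma> that] link_weight_vertex field_simps del: of_nat_add of_nat_Suc)
  from this[OF x y] this[OF y x]
  show "link_weight w \<sigma> x * link_kernel \<sigma> x y = link_weight w \<sigma> y * link_kernel \<sigma> y x"
    by (simp add: Un_commute)
qed

lemma link_mass:
  assumes \<sigma>: "\<sigma> \<in> sized s" and s: "s < N"
  shows "(\<Sum>x\<in>link_vertices \<sigma>. link_weight w \<sigma> x) = 1"
proof -
  have "(\<Sum>x\<in>link_vertices \<sigma>. link_weight w \<sigma> x)
    = (\<Sum>\<rho> | \<rho> \<in> sized (Suc s) \<and> \<sigma> \<subseteq> \<rho>. link_weight w \<sigma> (\<rho> - \<sigma>))"
    using sum_link_faces[OF \<sigma>, of "link_weight w \<sigma>" 1] by (simp add: link_vertices_def)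
  also have "\<dots> = (\<Sum>\<rho> | \<rho> \<in> sized (Suc s) \<and> \<sigma> \<subseteq> \<rho>. w \<rho> / (real (Suc s) * w \<sigma>))"
  proof (intro sum.cong refl)
    fix \<rho> assume \<rho>: "\<rho> \<in> {\<rho>. \<rho> \<in> sized (Suc s) \<and> \<sigma> \<subseteq> \<rho>}"
    then have "card (\<rho> - \<sigma>) = 1" "\<rho> - \<sigma> \<union> \<sigma> = \<rho>"
      using \<sigma> by (auto simp: card_Diff_subset sizedD)
    then show "link_weight w \<sigma> (\<rho> - \<sigma>) = w \<rho> / (real (Suc s) * w \<sigma>)"
      using link_weight_vertex[of \<sigma> s "\<rho> - \<sigma>"] sizedD(2)[OF \<sigma>] by simp
  qed
  also have "\<dots> = upsum (Suc s) (\<lambda>_. 1) \<sigma> / (real (Suc s) * w \<sigma>)"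
    by (simp add: upsum_def sum_divide_distrib)
  also have "\<dots> = 1"
    using upsum_Suc_one[OF \<sigma> s] weight_pos[OF sizedD(1)[OF \<sigma>]] by simp
  finally show ?thesis .
qed

lemma sum_link_vertices:
  assumes "\<sigma> \<in> sized s"
  shows "(\<Sum>x\<in>link_vertices \<sigma>. h (x \<union> \<sigma>)) = (\<Sum>\<alpha> | \<alpha> \<in> sized (Suc s) \<and> \<sigma> \<subseteq> \<alpha>. h \<alpha>)"
proof -
  have "(\<Sum>x\<in>link_vertices \<sigma>. h (x \<union> \<sigma>))
    = (\<Sum>\<alpha> | \<alpha> \<in> sized (Suc s) \<and> \<sigma> \<subseteq> \<alpha>. h (\<alpha> - \<sigma> \<union> \<sigma>))"
    using sum_link_faces[OF assms, of "\<lambda>x. h (x \<union> \<sigma>)" 1] by (simp add: link_vertices_def)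
  then show ?thesis by (auto intro!: sum.cong simp: Un_absorb2)
qed

section \<open>Garland's method: passing from links to the whole complex\<close>

lemma link_lambda2_eq:
  assumes "\<sigma> \<in> sized s" "s + 2 \<le> N"
  shows "link_lambda2 X w \<sigma> = second_eigenvalue (vanishing_off (link_vertices \<sigma>))
    (reversible_kernel.T (link_vertices \<sigma>) (link_kernel \<sigma>))"
proof -
  interpret K: reversible_kernel "link_vertices \<sigma>" "link_weight w \<sigma>" "link_kernel \<sigma>"
    using assms by (rule link_reversible_kernel)
  have "nonlazy_walk (link X \<sigma>) (link_weight w \<sigma>) 0 f x = K.T f x" for f x
  proof -
    have "(\<Sum>y | y \<in> link_vertices \<sigma> \<and> x \<union> y \<in> faces (link X \<sigma>) 1.
        link_weight (link_weight w \<sigma>) x (y - x) * f y)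
      = (\<Sum>y\<in>link_vertices \<sigma>. link_kernel \<sigma> x y * f y)"
      using K.finite_S unfolding sum.inter_filter[OF K.finite_S]
      by (intro sum.cong refl) (simp add: link_kernel_def)
    then show ?thesis
      by (simp add: nonlazy_walk_def K.T_def link_vertices_def[symmetric])
  qed
  then have "nonlazy_walk (link X \<sigma>) (link_weight w \<sigma>) 0 = K.T" by (simp add: fun_eq_iff)
  then show ?thesis
    by (simp add: link_lambda2_def cochains_def vanishing_off_def link_vertices_def)
qed

text \<open>This is \<open>quadratic_form_le\<close> for the localization \<open>g\<close> of
  \<open>f\<close> in the link of \<open>\<sigma>\<close>, cleared of denominators. The mean of
  \<open>g\<close> in the link is exactly \<open>down s f \<sigma>\<close>.\<close>

lemma local_quadratic_form_le:
  assumes \<sigma>: "\<sigma> \<in> sized s" and s: "s + 2 \<le> N" and l: "link_lambda2 X w \<sigma> \<le> l"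
  shows "(\<Sum>\<alpha> | \<alpha> \<in> sized (Suc s) \<and> \<sigma> \<subseteq> \<alpha>.
      \<Sum>\<beta> | \<beta> \<in> sized (Suc s) \<and> \<sigma> \<subseteq> \<beta> \<and> \<alpha> \<union> \<beta> \<in> sized (s + 2). w (\<alpha> \<union> \<beta>) * f \<alpha> * f \<beta>)
    \<le> real (s + 2) * (l * (\<Sum>\<alpha> | \<alpha> \<in> sized (Suc s) \<and> \<sigma> \<subseteq> \<alpha>. w \<alpha> * (f \<alpha>)\<^sup>2)
        + (1 - l) * (real (Suc s) * (w \<sigma> * (down s f \<sigma>)\<^sup>2)))"
    (is "?Q \<le> real (s + 2) * (l * ?A + (1 - l) * (real (Suc s) * ?B))")
proof -
  interpret K: reversible_kernel "link_vertices \<sigma>" "link_weight w \<sigma>" "link_kernel \<sigma>"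
    using \<sigma> s by (rule link_reversible_kernel)
  have \<sigma>X: "\<sigma> \<in> X" "card \<sigma> = s" using \<sigma> sizedD by auto
  have pos: "0 < w \<sigma>" using weight_pos \<sigma>X by blast
  note V = link_vertices_iff[OF \<sigma>X(1)]
  define c where "c = real (Suc s) * w \<sigma>"
  have c: "0 < c" using pos by (simp add: c_def)
  define g where "g x = (if x \<in> link_vertices \<sigma> then f (x \<union> \<sigma>) else 0)" for x
  have g: "g \<in> K.V" by (simp add: g_def vanishing_off_def)
  have p: "link_weight w \<sigma> x = w (x \<union> \<sigma>) / c" if "x \<in> link_vertices \<sigma>" for x
    using that V link_weight_vertex[OF \<sigma>X(2)] by (simp add: c_def)
  have 1: "K.ip g g = ?A / c"
  proof -
    have "K.ip g g = (\<Sum>x\<in>link_vertices \<sigma>. w (x \<union> \<sigma>) * (f (x \<union> \<sigma>))\<^sup>2 / c)"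
      unfolding wip_def by (intro sum.cong refl) (simp add: p g_def power2_eq_square)
    then show ?thesis
      unfolding sum_link_vertices[OF \<sigma>, of "\<lambda>\<alpha>. w \<alpha> * (f \<alpha>)\<^sup>2 / c"] by (simp add: sum_divide_distrib)
  qed
  have 2: "K.ip g K.one = down s f \<sigma>"
  proof -
    have "K.ip g K.one = (\<Sum>x\<in>link_vertices \<sigma>. w (x \<union> \<sigma>) * f (x \<union> \<sigma>) / c)"
      unfolding wip_def by (intro sum.cong refl) (simp add: p g_def K.one_def)
    then show ?thesis
      unfolding sum_link_vertices[OF \<sigma>, of "\<lambda>\<alpha>. w \<alpha> * f \<alpha> / c"]
      using \<sigma> by (simp add: sum_divide_distrib down_def upsum_def c_def)
  qed
  have 3: "K.ip (K.T g) g = ?Q / (real (s + 2) * c)"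
  proof -
    define H where "H \<alpha> \<beta> = (if \<alpha> \<union> \<beta> \<in> sized (s + 2)
      then w (\<alpha> \<union> \<beta>) * f \<alpha> * f \<beta> / (real (s + 2) * c) else 0)" for \<alpha> \<beta>
    have "K.ip (K.T g) g = (\<Sum>x\<in>link_vertices \<sigma>. \<Sum>y\<in>link_vertices \<sigma>. H (x \<union> \<sigma>) (y \<union> \<sigma>))"
      unfolding K.ip_T
    proof (intro sum.cong refl)
      fix x y assume xy: "x \<in> link_vertices \<sigma>" "y \<in> link_vertices \<sigma>"
      have cancel: "a / c * (b / (e * a)) * u * v = b * v * u / (e * c)" if "a \<noteq> 0" for a b e u v :: real
        using that c by (simp add: field_simps)
      have "x \<union> \<sigma> \<union> (y \<union> \<sigma>) = x \<union> y \<union> \<sigma>" by blast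
      moreover have "w (x \<union> \<sigma>) \<noteq> 0" using xy V weight_pos by force
      ultimately show "link_weight w \<sigma> x * link_kernel \<sigma> x y * g y * g x = H (x \<union> \<sigma>) (y \<union> \<sigma>)"
        using xy unfolding p[OF xy(1)] link_kernel_eq[OF \<sigma> xy] H_def g_def
        by (cases "x \<union> y \<union> \<sigma> \<in> sized (s + 2)")
          (simp_all only: if_True if_False cancel mult_zero_right mult_zero_left simp_thms)
    qed
    also have "\<dots> = (\<Sum>\<alpha> | \<alpha> \<in> sized (Suc s) \<and> \<sigma> \<subseteq> \<alpha>. \<Sum>\<beta> | \<beta> \<in> sized (Suc s) \<and> \<sigma> \<subseteq> \<beta>. H \<alpha> \<beta>)"
      unfolding sum_link_vertices[OF \<sigma>, of "H _"]
      by (rule sum_link_vertices[OF \<sigma>, of "\<lambda>\<alpha>. \<Sum>\<beta> | \<beta> \<in> sized (Suc s) \<and> \<sigma> \<subseteq> \<beta>. H \<alpha> \<beta>"])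
    also have "\<dots> = (\<Sum>\<alpha> | \<alpha> \<in> sized (Suc s) \<and> \<sigma> \<subseteq> \<alpha>.
      \<Sum>\<beta> | \<beta> \<in> sized (Suc s) \<and> \<sigma> \<subseteq> \<beta> \<and> \<alpha> \<union> \<beta> \<in> sized (s + 2). w (\<alpha> \<union> \<beta>) * f \<alpha> * f \<beta> / (real (s + 2) * c))"
    proof (rule sum.cong[OF refl])
      fix \<alpha>
      have filter: "{\<beta>. \<beta> \<in> sized (Suc s) \<and> \<sigma> \<subseteq> \<beta> \<and> \<alpha> \<union> \<beta> \<in> sized (s + 2)}
        = {\<beta> \<in> {\<beta>. \<beta> \<in> sized (Suc s) \<and> \<sigma> \<subseteq> \<beta>}. \<alpha> \<union> \<beta> \<in> sized (s + 2)}" by blast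
      show "(\<Sum>\<beta> | \<beta> \<in> sized (Suc s) \<and> \<sigma> \<subseteq> \<beta>. H \<alpha> \<beta>)
        = (\<Sum>\<beta> | \<beta> \<in> sized (Suc s) \<and> \<sigma> \<subseteq> \<beta> \<and> \<alpha> \<union> \<beta> \<in> sized (s + 2). w (\<alpha> \<union> \<beta>) * f \<alpha> * f \<beta> / (real (s + 2) * c))"
        unfolding H_def filter
        by (rule sum.inter_filter[symmetric]) (simp add: finite_sized)
    qed
    finally show ?thesis by (simp only: sum_divide_distrib)
  qed
  have mass: "(\<Sum>x\<in>link_vertices \<sigma>. link_weight w \<sigma> x) = 1"
    using link_mass[OF \<sigma>] s by simp
  have "?Q / (real (s + 2) * c) \<le> l * (?A / c) + (1 - l) * (down s f \<sigma>)\<^sup>2"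
    using K.quadratic_form_le[OF mass _ g, of l] l link_lambda2_eq[OF \<sigma> s]
    unfolding 1 2 3 by simp
  then have "?Q \<le> (l * (?A / c) + (1 - l) * (down s f \<sigma>)\<^sup>2) * (real (s + 2) * c)"
    using c by (subst (asm) pos_divide_le_eq) simp_all
  also have "\<dots> = real (s + 2) * (l * ?A + (1 - l) * (c * (down s f \<sigma>)\<^sup>2))"
  proof -
    have "(l * (a / c) + (1 - l) * b) * (e * c) = e * (l * a + (1 - l) * (c * b))" for a b e :: real
      using c by (simp add: field_simps)
    then show ?thesis .
  qed
  finally show ?thesis by (simp only: c_def mult.assoc)
qed

text \<open>A top face above \<open>\<sigma>\<close> gives the link at least \<open>N - s\<close>
  vertices. Since the eigenvalue is negative, replacing the number of vertices by this smaller
  number weakens the bound of \<open>second_eigenvalue_lower_bound\<close>.\<close>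

lemma link_lambda2_lower_bound:
  assumes \<sigma>: "\<sigma> \<in> sized s" and s: "s + 2 \<le> N" and neg: "link_lambda2 X w \<sigma> < 0"
  shows "-1 \<le> link_lambda2 X w \<sigma> * real (N - s - 1)"
proof -
  interpret K: reversible_kernel "link_vertices \<sigma>" "link_weight w \<sigma>" "link_kernel \<sigma>"
    using \<sigma> s by (rule link_reversible_kernel)
  have \<sigma>X: "\<sigma> \<in> X" "card \<sigma> = s" using \<sigma> sizedD by auto
  have "link_kernel \<sigma> x x = 0" if "x \<in> link_vertices \<sigma>" for x
    using that link_edges_iff[OF \<sigma>X(1)] link_vertices_iff[OF \<sigma>X(1)] by (simp add: link_kernel_def)
  moreover have "(\<Sum>x\<in>link_vertices \<sigma>. link_weight w \<sigma> x) = 1"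
    using link_mass[OF \<sigma>] s by simp
  ultimately have "-1 \<le> link_lambda2 X w \<sigma> * (real (card (link_vertices \<sigma>)) - 1)"
    using K.second_eigenvalue_lower_bound neg unfolding link_lambda2_eq[OF \<sigma> s] by blast
  also have "\<dots> \<le> link_lambda2 X w \<sigma> * real (N - s - 1)"
  proof (rule mult_left_mono_neg)
    obtain \<tau> where \<tau>: "\<tau> \<in> sized N" "\<sigma> \<subseteq> \<tau>" using subset_top \<sigma>X by blast
    have "(\<lambda>v. {v}) ` (\<tau> - \<sigma>) \<subseteq> link_vertices \<sigma>"
    proof
      fix x assume "x \<in> (\<lambda>v. {v}) ` (\<tau> - \<sigma>)"
      then obtain v where v: "x = {v}" "v \<in> \<tau>" "v \<notin> \<sigma>" by blast
      moreover have "x \<union> \<sigma> \<in> X"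
        using complex(4)[of \<tau> "x \<union> \<sigma>"] \<tau> v sizedD(1) by blast
      ultimately show "x \<in> link_vertices \<sigma>" by (simp add: link_vertices_iff[OF \<sigma>X(1)])
    qed
    then have "card (\<tau> - \<sigma>) \<le> card (link_vertices \<sigma>)"
      using card_mono[OF K.finite_S] by (metis card_image inj_singleton inj_on_subset subset_UNIV)
    moreover have "card (\<tau> - \<sigma>) = N - s"
      using \<tau> sizedD(2,3)[OF \<sigma>] by (simp add: card_Diff_subset sized_def)
    ultimately show "real (N - s - 1) \<le> real (card (link_vertices \<sigma>)) - 1"
      using s by linarith
  qed (use neg in simp)
  finally show ?thesis .
qed

text \<open>If the union of two faces of size \<open>s + 1\<close> has size \<open>s + 2\<close>,
  they share exactly one face of size \<open>s\<close>, namely their intersection. Each pair is thus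
  seen in exactly one link.\<close>

lemma walk_form_eq_sum_links:
  "walk_form (Suc s) f = (\<Sum>\<sigma>\<in>sized s. \<Sum>\<alpha> | \<alpha> \<in> sized (Suc s) \<and> \<sigma> \<subseteq> \<alpha>.
     \<Sum>\<beta> | \<beta> \<in> sized (Suc s) \<and> \<sigma> \<subseteq> \<beta> \<and> \<alpha> \<union> \<beta> \<in> sized (s + 2). w (\<alpha> \<union> \<beta>) * f \<alpha> * f \<beta>)"
proof -
  let ?B = "\<lambda>\<alpha>. {\<beta> \<in> sized (Suc s). \<alpha> \<union> \<beta> \<in> sized (s + 2)}"
  let ?h = "\<lambda>\<alpha> \<beta>. w (\<alpha> \<union> \<beta>) * f \<alpha> * f \<beta>"
  have "(\<Sum>\<sigma>\<in>sized s. \<Sum>\<alpha> | \<alpha> \<in> sized (Suc s) \<and> \<sigma> \<subseteq> \<alpha>.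
      \<Sum>\<beta> | \<beta> \<in> sized (Suc s) \<and> \<sigma> \<subseteq> \<beta> \<and> \<alpha> \<union> \<beta> \<in> sized (s + 2). ?h \<alpha> \<beta>)
    = (\<Sum>\<sigma>\<in>sized s. \<Sum>\<alpha> | \<alpha> \<in> sized (Suc s) \<and> \<sigma> \<subseteq> \<alpha>. \<Sum>\<beta> | \<beta> \<in> ?B \<alpha> \<and> \<sigma> \<subseteq> \<beta>. ?h \<alpha> \<beta>)"
    by (intro sum.cong refl) auto
  also have "\<dots> = (\<Sum>\<alpha>\<in>sized (Suc s). \<Sum>\<sigma> | \<sigma> \<in> sized s \<and> \<sigma> \<subseteq> \<alpha>. \<Sum>\<beta> | \<beta> \<in> ?B \<alpha> \<and> \<sigma> \<subseteq> \<beta>. ?h \<alpha> \<beta>)"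
    by (rule sum.swap_restrict) (simp_all add: finite_sized)
  also have "\<dots> = (\<Sum>\<alpha>\<in>sized (Suc s). \<Sum>\<beta>\<in>?B \<alpha>. \<Sum>\<sigma> | \<sigma> \<in> {\<sigma> \<in> sized s. \<sigma> \<subseteq> \<alpha>} \<and> \<sigma> \<subseteq> \<beta>. ?h \<alpha> \<beta>)"
    by (intro sum.cong refl sum.swap_restrict) (simp_all add: finite_sized)
  also have "\<dots> = (\<Sum>\<alpha>\<in>sized (Suc s). \<Sum>\<beta>\<in>?B \<alpha>. ?h \<alpha> \<beta>)"
  proof (intro sum.cong refl)
    fix \<alpha> \<beta> assume \<alpha>: "\<alpha> \<in> sized (Suc s)" and \<beta>: "\<beta> \<in> ?B \<alpha>"
    have fin: "finite \<alpha>" "finite \<beta>" using \<alpha> \<beta> sizedD(3) by blast+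
    have "card \<alpha> = Suc s" "card \<beta> = Suc s" "card (\<alpha> \<union> \<beta>) = s + 2"
      using \<alpha> \<beta> sizedD(2) by auto
    then have int: "card (\<alpha> \<inter> \<beta>) = s"
      using card_Un_Int[OF fin] by simp
    have "{\<sigma>. \<sigma> \<in> {\<sigma> \<in> sized s. \<sigma> \<subseteq> \<alpha>} \<and> \<sigma> \<subseteq> \<beta>} = {\<alpha> \<inter> \<beta>}"
    proof -
      have "\<alpha> \<inter> \<beta> \<in> sized s"
        using int complex(4)[of \<alpha> "\<alpha> \<inter> \<beta>"] sizedD(1)[OF \<alpha>] by (simp add: sized_def)
      moreover have "\<sigma> = \<alpha> \<inter> \<beta>" if "\<sigma> \<in> sized s" "\<sigma> \<subseteq> \<alpha>" "\<sigma> \<subseteq> \<beta>" for \<sigma>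
        using that int fin sizedD(2)[OF that(1)] by (intro card_subset_eq) auto
      ultimately show ?thesis by blast
    qed
    then show "(\<Sum>\<sigma> | \<sigma> \<in> {\<sigma> \<in> sized s. \<sigma> \<subseteq> \<alpha>} \<and> \<sigma> \<subseteq> \<beta>. ?h \<alpha> \<beta>) = ?h \<alpha> \<beta>"
      by simp
  qed
  finally show ?thesis by (simp add: walk_form_def)
qed

lemma sum_local_norms:
  "(\<Sum>\<sigma>\<in>sized s. \<Sum>\<alpha> | \<alpha> \<in> sized (Suc s) \<and> \<sigma> \<subseteq> \<alpha>. w \<alpha> * (f \<alpha>)\<^sup>2) = real (Suc s) * cochain.ip (Suc s) f f"
proof -
  have "(\<Sum>\<sigma>\<in>sized s. \<Sum>\<alpha> | \<alpha> \<in> sized (Suc s) \<and> \<sigma> \<subseteq> \<alpha>. w \<alpha> * (f \<alpha>)\<^sup>2)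
    = (\<Sum>\<alpha>\<in>sized (Suc s). \<Sum>\<sigma> | \<sigma> \<in> sized s \<and> \<sigma> \<subseteq> \<alpha>. w \<alpha> * (f \<alpha>)\<^sup>2)"
    by (rule sum.swap_restrict) (simp_all add: finite_sized)
  also have "\<dots> = (\<Sum>\<alpha>\<in>sized (Suc s). real (Suc s) * (w \<alpha> * (f \<alpha>)\<^sup>2))"
  proof (intro sum.cong refl)
    fix \<alpha> assume \<alpha>: "\<alpha> \<in> sized (Suc s)"
    have "{\<sigma>. \<sigma> \<in> sized s \<and> \<sigma> \<subseteq> \<alpha>} = {\<sigma>. \<sigma> \<subseteq> \<alpha> \<and> card \<sigma> = s}"
      using \<alpha> complex(4) by (auto simp: sized_def)
    then have "card {\<sigma>. \<sigma> \<in> sized s \<and> \<sigma> \<subseteq> \<alpha>} = Suc s"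
      using sizedD(2,3)[OF \<alpha>] by (simp add: n_subsets)
    then show "(\<Sum>\<sigma> | \<sigma> \<in> sized s \<and> \<sigma> \<subseteq> \<alpha>. w \<alpha> * (f \<alpha>)\<^sup>2) = real (Suc s) * (w \<alpha> * (f \<alpha>)\<^sup>2)"
      by simp
  qed
  finally show ?thesis
    by (simp add: wip_def sum_distrib_left power2_eq_square mult.assoc)
qed

text \<open>Sum the local estimates over all \<open>\<sigma>\<close>. Each face of size
  \<open>s + 1\<close> has \<open>s + 1\<close> facets, which accounts for the multiplicity in
  \<open>sum_local_norms\<close>.\<close>

lemma walk_form_le:
  assumes s: "s + 2 \<le> N" and l: "\<And>\<sigma>. \<sigma> \<in> sized s \<Longrightarrow> link_lambda2 X w \<sigma> \<le> l"
  shows "walk_form (Suc s) f \<le> real (Suc s) * real (s + 2) *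
    (l * cochain.ip (Suc s) f f + (1 - l) * cochain.ip s (down s f) (down s f))"
proof -
  let ?A = "\<lambda>\<sigma>. \<Sum>\<alpha> | \<alpha> \<in> sized (Suc s) \<and> \<sigma> \<subseteq> \<alpha>. w \<alpha> * (f \<alpha>)\<^sup>2"
  let ?B = "\<lambda>\<sigma>. w \<sigma> * (down s f \<sigma>)\<^sup>2"
  have "walk_form (Suc s) f \<le> (\<Sum>\<sigma>\<in>sized s. real (s + 2) * (l * ?A \<sigma> + (1 - l) * (real (Suc s) * ?B \<sigma>)))"
    unfolding walk_form_eq_sum_links by (intro sum_mono local_quadratic_form_le s l)
  also have "\<dots> = real (s + 2) * (l * (\<Sum>\<sigma>\<in>sized s. ?A \<sigma>) + (1 - l) * (real (Suc s) * (\<Sum>\<sigma>\<in>sized s. ?B \<sigma>)))"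
    by (simp only: sum_distrib_left[symmetric] sum.distrib)
  also note sum_local_norms
  also have "(\<Sum>\<sigma>\<in>sized s. ?B \<sigma>) = cochain.ip s (down s f) (down s f)"
    by (simp add: wip_def power2_eq_square mult.assoc)
  also have "real (s + 2) * (l * (real (Suc s) * a) + (1 - l) * (real (Suc s) * b))
    = real (Suc s) * real (s + 2) * (l * a + (1 - l) * b)" for a b
    by (simp add: algebra_simps)
  finally show ?thesis .
qed

subsection \<open>Level cochains\<close>

text \<open>In \<open>lev n i\<close> and \<open>plev n i\<close> the cochains live on faces of cardinality \<open>n\<close>, that is in
  dimension \<open>k = n - 1\<close>, whereas \<open>i\<close> is the level itself.\<close>

definition lev :: "nat \<Rightarrow> nat \<Rightarrow> ('a set \<Rightarrow> real) \<Rightarrow> bool" where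
  "lev n i f \<longleftrightarrow> f \<in> cochain.V n \<and> (\<forall>\<sigma>\<in>sized i. upsum n f \<sigma> = 0)"

definition plev :: "nat \<Rightarrow> nat \<Rightarrow> ('a set \<Rightarrow> real) \<Rightarrow> bool" where
  "plev n i f \<longleftrightarrow> lev n i f \<and> (\<forall>g. lev n (Suc i) g \<longrightarrow> cochain.ip n f g = 0)"

lemma proper_level_iff: "i < n \<Longrightarrow> proper_level X w (int n - 1) (int i) f \<longleftrightarrow> plev n i f"
  using level_iff[of i n] level_iff[of "Suc i" n]
  by (simp add: proper_level_def plev_def lev_def cochain_inner_eq add.commute)

lemma subspace_lev: "rfun.subspace {f. lev n i f}"
proof (rule rfun.subspaceI; unfold mem_Collect_eq)
  show "lev n i 0" by (simp add: lev_def vanishing_off_def upsum_def)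
next
  fix f g assume "lev n i f" "lev n i g"
  then show "lev n i (f + g)"
    using rfun.subspace_add[OF cochain.subspace_V[of n], of f g] unfolding lev_def upsum_add by simp
next
  fix c f assume "lev n i f"
  then show "lev n i (\<lambda>x. c * f x)"
    using rfun.subspace_scale[OF cochain.subspace_V[of n], of f c] unfolding lev_def upsum_scale by simp
qed

text \<open>By \<open>sum_upsum\<close>, the sum of the vanishing values one size up is
  \<open>n - i\<close> times the value at \<open>\<sigma>\<close>, and \<open>n - i\<close> is
  positive.\<close>

lemma lev_Suc_imp_lev:
  assumes "lev n (Suc i) f" "i < n"
  shows "lev n i f"
proof -
  have "upsum n f \<sigma> = 0" if \<sigma>: "\<sigma> \<in> sized i" for \<sigma>
  proof -
    have "(\<Sum>\<tau> | \<tau> \<in> sized (Suc i) \<and> \<sigma> \<subseteq> \<tau>. upsum n f \<tau>) = 0"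
      using assms by (intro sum.neutral) (auto simp: lev_def)
    then show ?thesis using sum_upsum[OF \<sigma>, of "Suc i" n f] assms(2) by (simp add: Suc_diff_le)
  qed
  then show ?thesis using assms by (auto simp: lev_def)
qed

lemma lev_antimono:
  assumes "lev n j f" "i \<le> j" "j \<le> n"
  shows "lev n i f"
  using assms(2,1,3) by (induction i rule: inc_induct) (auto intro: lev_Suc_imp_lev)

text \<open>The only face of size \<open>n\<close> above a face of size \<open>n\<close> is the face
  itself, so the level condition reads \<open>w \<sigma> * f \<sigma> = 0\<close>.\<close>

lemma lev_self:
  assumes "lev n n f"
  shows "f = 0"
proof -
  have "f \<sigma> = 0" if \<sigma>: "\<sigma> \<in> sized n" for \<sigma>
  proof -
    have "\<rho> = \<sigma>" if "\<rho> \<in> sized n" "\<sigma> \<subseteq> \<rho>" for \<rho>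
      using that sizedD(2)[OF \<sigma>] sizedD(2,3)[OF that(1)] card_subset_eq[of \<rho> \<sigma>] by simp
    then have "{\<rho>. \<rho> \<in> sized n \<and> \<sigma> \<subseteq> \<rho>} = {\<sigma>}" using \<sigma> by blast
    then have "upsum n f \<sigma> = w \<sigma> * f \<sigma>" by (simp add: upsum_def)
    then show ?thesis using assms \<sigma> weight_pos[OF sizedD(1)[OF \<sigma>]] by (simp add: lev_def)
  qed
  then show ?thesis using assms by (auto simp: lev_def vanishing_off_def fun_eq_iff)
qed

text \<open>Summing \<open>down n f\<close> above \<open>\<sigma>\<close> sums the values of
  \<open>upsum (Suc n) f\<close> one size higher, a multiple of its value at \<open>\<sigma>\<close>
  by \<open>sum_upsum\<close>.\<close>

lemma lev_down:
  assumes f: "lev (Suc n) i f" and i: "i \<le> n"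
  shows "lev n i (down n f)"
proof -
  have "upsum n (down n f) \<sigma> = 0" if \<sigma>: "\<sigma> \<in> sized i" for \<sigma>
  proof -
    have "upsum n (down n f) \<sigma> = (\<Sum>\<tau> | \<tau> \<in> sized n \<and> \<sigma> \<subseteq> \<tau>. upsum (Suc n) f \<tau> / real (Suc n))"
      unfolding upsum_def[of n]
    proof (intro sum.cong refl)
      fix \<tau> assume \<tau>: "\<tau> \<in> {\<tau>. \<tau> \<in> sized n \<and> \<sigma> \<subseteq> \<tau>}"
      then have "w \<tau> \<noteq> 0" using weight_pos sizedD(1) by force
      then show "w \<tau> * down n f \<tau> = upsum (Suc n) f \<tau> / real (Suc n)"
        using \<tau> by (simp add: down_def del: of_nat_Suc)
    qed
    also have "\<dots> = (\<Sum>\<tau> | \<tau> \<in> sized n \<and> \<sigma> \<subseteq> \<tau>. upsum (Suc n) f \<tau>) / real (Suc n)"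
      by (simp only: sum_divide_distrib)
    also have "\<dots> = 0"
      using sum_upsum[OF \<sigma> i] f \<sigma> by (simp add: lev_def)
    finally show ?thesis .
  qed
  then show ?thesis using down_in_V by (simp add: lev_def)
qed

text \<open>Peel off one level at a time: the error \<open>h - r\<close> of the projection onto
  level \<open>m + 1\<close> is proper of level \<open>m\<close>, and \<open>r\<close> is decomposed
  further. The process ends because level \<open>n\<close> contains only 0.\<close>

lemma proper_decomposition:
  assumes "m \<le> n" "lev n m h"
  shows "\<exists>g. (\<forall>i\<in>{m..<n}. plev n i (g i)) \<and> h = (\<Sum>i=m..<n. g i)"
  using assms
proof (induction m arbitrary: h rule: inc_induct)
  case base
  have "h = 0" using base by (rule lev_self)
  show ?case unfolding \<open>h = 0\<close> by simp
next
  case (step m)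
  have hV: "h \<in> cochain.V n" using step.prems by (simp add: lev_def)
  obtain r where r: "lev n (Suc m) r" "\<And>g. lev n (Suc m) g \<Longrightarrow> cochain.ip n (h - r) g = 0"
    using cochain.orthogonal_projection[OF subspace_lev[of n "Suc m"] _ hV]
    by (auto simp: lev_def)
  obtain g where g: "\<forall>i\<in>{Suc m..<n}. plev n i (g i)" "r = (\<Sum>i=Suc m..<n. g i)"
    using step.IH[OF r(1)] by blast
  have "lev n m (h - r)"
    using rfun.subspace_diff[OF subspace_lev[of n m], of h r] step.prems
      lev_Suc_imp_lev[OF r(1) step.hyps(2)] by (simp only: mem_Collect_eq)
  then have "plev n m (h - r)" using r(2) by (simp add: plev_def)
  then have "\<forall>i\<in>{m..<n}. plev n i ((g(m := h - r)) i)"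
    using g(1) by auto
  moreover have "h = (\<Sum>i=m..<n. (g(m := h - r)) i)"
  proof -
    have "(\<Sum>i=m..<n. (g(m := h - r)) i) = (h - r) + (\<Sum>i=Suc m..<n. (g(m := h - r)) i)"
      using step.hyps(2) by (simp add: sum.atLeast_Suc_lessThan)
    also have "(\<Sum>i=Suc m..<n. (g(m := h - r)) i) = r"
      unfolding g(2) by (intro sum.cong) auto
    finally show ?thesis by (simp only: diff_add_cancel)
  qed
  ultimately show ?case by blast
qed

lemma plev_orthogonal:
  assumes "plev n i f" "lev n j g" "i < j" "j \<le> n"
  shows "cochain.ip n f g = 0"
  using assms lev_antimono[of n j g "Suc i"] by (auto simp: plev_def)

lemma plev_orthogonal_plev:
  assumes "plev n i f" "plev n j g" "i \<noteq> j" "i < n" "j < n"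
  shows "cochain.ip n f g = 0"
proof (cases "i < j")
  case True
  then show ?thesis using plev_orthogonal[of n i f j g] assms by (simp add: plev_def)
next
  case False
  then have "cochain.ip n g f = 0"
    using plev_orthogonal[of n j g i f] assms by (simp add: plev_def)
  then show ?thesis by (simp add: wip_commute)
qed

lemma plev_zero: "plev n i 0"
  by (simp add: plev_def lev_def vanishing_off_def upsum_def wip_zero_left[unfolded zero_fun_def] zero_fun_def)

lemma plev_norm_sum:
  assumes "\<And>i. i < n \<Longrightarrow> plev n i (f i)"
  shows "cochain.ip n (\<Sum>i<n. f i) (\<Sum>i<n. f i) = (\<Sum>i<n. cochain.ip n (f i) (f i))"
  using assms by (intro cochain.ip_orthogonal_sum) (auto intro: plev_orthogonal_plev)

text \<open>A duality argument along the level filtration. With \<open>H\<close> the image under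
  \<open>down\<close>, pair \<open>H\<close> with itself, split each pairing by the
  arithmetic-geometric mean inequality, and absorb the part that is again bounded by the norm of
  \<open>H\<close>.\<close>

lemma down_norm_le:
  assumes f: "\<And>i. i \<le> n \<Longrightarrow> plev (Suc n) i (f i)"
    and pos: "\<And>i. i < n \<Longrightarrow> 0 < b i"
    and anti: "\<And>i. Suc i < n \<Longrightarrow> b (Suc i) \<le> b i"
    and up: "\<And>g. (\<And>i. i < n \<Longrightarrow> plev n i (g i)) \<Longrightarrow>
      cochain.ip (Suc n) (up n (\<Sum>i<n. g i)) (up n (\<Sum>i<n. g i)) \<le> (\<Sum>i<n. b i * cochain.ip n (g i) (g i))"
  shows "cochain.ip n (down n (\<Sum>i\<le>n. f i)) (down n (\<Sum>i\<le>n. f i))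
    \<le> (\<Sum>i<n. b i * cochain.ip (Suc n) (f i) (f i))"
proof -
  have lev: "lev (Suc n) i (f i)" if "i \<le> n" for i using f[OF that] by (simp add: plev_def)
  \<comment> \<open>The image of the top component has level \<open>n\<close> on faces of size
    \<open>n\<close>, so it is 0; hence only \<open>n\<close> terms remain.\<close>
  have "down n (f n) = 0" using lev_self lev_down lev by blast
  then have sum: "down n (\<Sum>i\<le>n. f i) = (\<Sum>i<n. down n (f i))"
    unfolding down_sum lessThan_Suc_atMost[symmetric] sum.lessThan_Suc[of "\<lambda>i. down n (f i)"]
    by (simp only: add_0_right)
  define H where "H = (\<Sum>i<n. down n (f i))"
  have "lev n 0 (down n (f i))" if "i < n" for i
    using lev_antimono[OF lev_down[OF lev]] that by simp
  then have "lev n 0 H"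
    unfolding H_def using rfun.subspace_sum[OF subspace_lev[of n 0], of "{..<n}" "\<lambda>i. down n (f i)"]
    by simp
  then obtain h where "\<forall>i\<in>{0..<n}. plev n i (h i)" "H = (\<Sum>i=0..<n. h i)"
    using proper_decomposition[of 0 n H] by blast
  then have h: "\<And>i. i < n \<Longrightarrow> plev n i (h i)" and H: "H = (\<Sum>i<n. h i)"
    by (simp_all only: atLeast0LessThan) simp_all
  \<comment> \<open>For \<open>m \<le> i\<close> the pairing of \<open>f i\<close> with \<open>up n (tl m)\<close> does not depend on \<open>m\<close>, so Bessel bounds
    each tail of the sum of the \<open>(y i)\<^sup>2\<close>; Abel summation then introduces the weights \<open>1 / b i\<close>.\<close>
  define tl where "tl m = (\<Sum>i=m..<n. h i)" for m
  define y where "y i = cochain.ip n (down n (f i)) H" for i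
  have y: "y i = cochain.ip (Suc n) (f i) (up n (tl m))" if "m \<le> i" "i < n" for i m
  proof -
    have "H = (\<Sum>j<m. h j) + tl m"
      using that by (simp only: H tl_def lessThan_atLeast0) (simp add: sum.atLeastLessThan_concat)
    moreover have "cochain.ip n (down n (f i)) (\<Sum>j<m. h j) = 0"
    proof -
      have "cochain.ip n (h j) (down n (f i)) = 0" if "j < m" for j
        using plev_orthogonal[of n j "h j" i] h lev_down[OF lev, of i] that \<open>m \<le> i\<close> \<open>i < n\<close> by simp
      then show ?thesis by (subst wip_commute) (simp add: wip_sum_left)
    qed
    ultimately show ?thesis by (simp only: y_def wip_add_right down_adjoint)
  qed
  let ?z = "\<lambda>i. (y i)\<^sup>2 / cochain.ip (Suc n) (f i) (f i)"
  have tail: "(\<Sum>i=m..<n. ?z i) \<le> (\<Sum>i=m..<n. b i * cochain.ip n (h i) (h i))" if "m < n" for m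
  proof -
    \<comment> \<open>The hypothesis \<open>up\<close> expects a proper cochain at every level below
      \<open>n\<close>, so the tail is padded with zeros.\<close>
    define g where "g i = (if m \<le> i then h i else 0)" for i
    have "(\<Sum>i=m..<n. ?z i)
      = (\<Sum>i=m..<n. (cochain.ip (Suc n) (f i) (up n (tl m)))\<^sup>2 / cochain.ip (Suc n) (f i) (f i))"
      by (intro sum.cong refl) (simp add: y[of m])
    also have "\<dots> \<le> cochain.ip (Suc n) (up n (tl m)) (up n (tl m))"
      using f by (intro cochain.bessel) (auto intro!: plev_orthogonal_plev[of "Suc n"])
    also have "tl m = (\<Sum>i<n. g i)"
      unfolding tl_def g_def by (intro sum.mono_neutral_cong_left) auto
    also have "cochain.ip (Suc n) (up n (\<Sum>i<n. g i)) (up n (\<Sum>i<n. g i)) \<le> (\<Sum>i<n. b i * cochain.ip n (g i) (g i))"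
      by (rule up) (simp add: g_def h plev_zero[unfolded zero_fun_def] zero_fun_def)
    also have "\<dots> = (\<Sum>i=m..<n. b i * cochain.ip n (h i) (h i))"
      by (intro sum.mono_neutral_cong_right) (auto simp: g_def wip_simps)
    finally show ?thesis .
  qed
  have "(\<Sum>i<n. ?z i / b i) \<le> (\<Sum>i<n. cochain.ip n (h i) (h i))"
    by (rule weighted_tail_sum_bound[OF tail pos anti])
  also have "\<dots> = cochain.ip n H H"
    unfolding H using plev_norm_sum[OF h] by simp
  finally have z: "(\<Sum>i<n. ?z i / b i) \<le> cochain.ip n H H" .
  have "cochain.ip n H H = (\<Sum>i<n. y i)"
    by (subst H_def) (simp add: wip_sum_left y_def)
  \<comment> \<open>Arithmetic-geometric mean with \<open>t = b i * a\<close>, where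
    \<open>a\<close> is the squared norm of \<open>f i\<close>. If \<open>a = 0\<close>, both
    \<open>f i\<close> and \<open>y i\<close> vanish and the division by 0 also yields 0.\<close>
  also have "\<dots> \<le> (\<Sum>i<n. (b i * cochain.ip (Suc n) (f i) (f i) + ?z i / b i) / 2)"
  proof (intro sum_mono)
    fix i assume "i \<in> {..<n}"
    then have i: "i < n" by simp
    define a where "a = cochain.ip (Suc n) (f i) (f i)"
    show "y i \<le> (b i * cochain.ip (Suc n) (f i) (f i) + ?z i / b i) / 2"
    proof (cases "a = 0")
      case True
      then have "f i = 0"
        using cochain.ip_eq_0_iff[of "f i" "Suc n"] f[of i] i by (simp add: a_def plev_def lev_def)
      then have "y i = 0"
        using y[of i i] i by (simp add: wip_simps)
      then show ?thesis using True by (simp add: a_def)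
    next
      case False
      then have a: "0 < a" using cochain.ip_nonneg[of "Suc n" "f i"] by (simp add: a_def)
      define t where "t = b i * a"
      have t: "0 < t" using a pos[OF i] by (simp add: t_def)
      have "0 \<le> (t - y i)\<^sup>2 / t" using t by simp
      also have "\<dots> = t + (y i)\<^sup>2 / t - 2 * y i"
        using t by (simp add: power2_diff field_simps power2_eq_square)
      finally show ?thesis
        using pos[OF i] a by (simp add: t_def a_def[symmetric] mult.commute)
    qed
  qed
  also have "\<dots> = ((\<Sum>i<n. b i * cochain.ip (Suc n) (f i) (f i)) + (\<Sum>i<n. ?z i / b i)) / 2"
    by (simp only: sum_divide_distrib[symmetric] sum.distrib)
  finally have le: "cochain.ip n H H
    \<le> ((\<Sum>i<n. b i * cochain.ip (Suc n) (f i) (f i)) + (\<Sum>i<n. ?z i / b i)) / 2" .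
  \<comment> \<open>Absorption: the second half of the mean is at most half of the quantity being
    estimated.\<close>
  have "x \<le> u" if "x \<le> (u + v) / 2" "v \<le> x" for x u v :: real
    using that by (simp add: field_simps)
  from this[OF le z] show ?thesis unfolding sum H_def[symmetric] .
qed

text \<open>Induction on cardinality, with \<open>g s\<close> standing for \<open>\<gamma>\<close>
  in dimension \<open>s - 1\<close>. The previous case bounds \<open>up\<close>,
  \<open>down_norm_le\<close> transfers the bound to \<open>down\<close>, and
  \<open>walk_form_le\<close> adds one more factor to the products.\<close>

lemma walk_form_proper_le:
  fixes g :: "nat \<Rightarrow> real"
  assumes n: "n < N"
    and lam: "\<And>s \<sigma>. s < n \<Longrightarrow> \<sigma> \<in> sized s \<Longrightarrow> link_lambda2 X w \<sigma> \<le> g s"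
    and low: "\<And>s. s < n \<Longrightarrow> -1 \<le> g s * real (N - s - 1)"
    and up: "\<And>s. 0 < s \<Longrightarrow> s < n \<Longrightarrow> g s \<le> 1"
    and f: "\<And>i. i < n \<Longrightarrow> plev n i (f i)"
  shows "walk_form n (\<Sum>i<n. f i) \<le> real n * real (Suc n) *
    (\<Sum>i<n. (1 - (\<Prod>s=i..<n. 1 - g s) / real (n - i)) * cochain.ip n (f i) (f i))"
  using assms
proof (induction n arbitrary: f)
  case 0
  show ?case by (simp add: walk_form_def)
next
  case (Suc n)
  define P where "P i = (\<Prod>s=i..<n. 1 - g s)" for i
  have P_Suc: "P i = (1 - g i) * P (Suc i)" if "i < n" for i
    using that by (simp add: P_def prod.atLeast_Suc_lessThan)
  \<comment> \<open>The factor \<open>1 - g 0\<close> has no sign constraint; it enters only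
    \<open>P 0\<close>, hence the condition on \<open>i\<close>.\<close>
  have P_nonneg: "0 \<le> P i" if "0 < i" for i
    unfolding P_def using that Suc.prems(4) by (intro prod_nonneg) auto
  \<comment> \<open>The target coefficient for size \<open>n + 1\<close> with its last factor
    \<open>1 - g n\<close> removed; it will bound both \<open>up\<close> and
    \<open>down\<close>.\<close>
  define b where "b i = 1 - P i / real (Suc n - i)" for i
  \<comment> \<open>For negative \<open>g i\<close> the multiplier \<open>N - i - 1\<close> may be
    lowered to \<open>Suc n - i\<close>, because \<open>Suc n < N\<close>.\<close>
  have g_low: "-1 \<le> g i * real (Suc n - i)" if "i < n" for i
  proof (cases "g i \<ge> 0")
    case True
    then have "0 \<le> g i * real (Suc n - i)" by simp
    then show ?thesis by linarith
  next
    case False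
    have "g i * real (N - i - 1) \<le> g i * real (Suc n - i)"
      using False Suc.prems(1) by (intro mult_left_mono_neg) auto
    then show ?thesis using Suc.prems(3)[of i] that by linarith
  qed
  \<comment> \<open>Since \<open>P (Suc i)\<close> is nonnegative, it suffices to compare
    \<open>(1 - g i) / (r + 1)\<close> with \<open>1 / r\<close>, which amounts to
    \<open>- g i * r \<le> 1\<close>: this is where the lower bound on the link eigenvalues
    enters.\<close>
  have anti: "b (Suc i) \<le> b i" if i: "i < n" for i
  proof -
    define r where "r = real (n - i)"
    have r: "0 < r" "real (Suc n - i) = r + 1" using i by (auto simp: r_def)
    have "- (g i) * r \<le> 1"
    proof (cases "g i \<ge> 0")
      case True
      then have "0 \<le> g i * r" using r(1) by simp
      then show ?thesis by simp
    next
      case False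
      have "-1 \<le> g i * (r + 1)" using g_low[OF i] r by simp
      then show ?thesis using False by (simp add: algebra_simps)
    qed
    then have "(1 - g i) / (r + 1) \<le> 1 / r"
      using r by (simp add: field_simps)
    then have "(1 - g i) / (r + 1) * P (Suc i) \<le> 1 / r * P (Suc i)"
      using P_nonneg by (intro mult_right_mono) auto
    then show ?thesis
      using r by (simp add: b_def P_Suc[OF i] r_def[symmetric])
  qed
  \<comment> \<open>By monotonicity only the last index \<open>n - 1\<close> matters. There
    \<open>b\<close> equals \<open>(1 + g (n - 1)) / 2\<close>, and \<open>g (n - 1)\<close> is at
    least -1/2.\<close>
  have pos: "0 < b i" if "i < n" for i
  proof -
    have "i \<le> n - 1" using that by simp
    then show ?thesis
    proof (induction i rule: inc_induct)
      case base
      have "Suc n - (n - 1) = 2" "Suc (n - 1) = n" using that by auto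
      then have "P (n - 1) = 1 - g (n - 1)" "-1 \<le> g (n - 1) * 2"
        using P_Suc[of "n - 1"] g_low[of "n - 1"] that by (simp_all add: P_def)
      then show ?case using \<open>Suc n - (n - 1) = 2\<close> by (simp add: b_def)
    next
      case (step i)
      then have "i < n" by simp
      then show ?case using anti step.IH less_le_trans by blast
    qed
  qed
  \<comment> \<open>By \<open>up_norm\<close> the induction hypothesis gives the coefficients
    \<open>(1 + real n * c) / real (Suc n)\<close>, where \<open>c\<close> is the coefficient for
    size \<open>n\<close>; these are then weakened to \<open>b i\<close>.\<close>
  have up: "cochain.ip (Suc n) (up n (\<Sum>i<n. h i)) (up n (\<Sum>i<n. h i))
      \<le> (\<Sum>i<n. b i * cochain.ip n (h i) (h i))" if h: "\<And>i. i < n \<Longrightarrow> plev n i (h i)" for h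
  proof -
    let ?G = "\<Sum>i<n. h i" and ?q = "\<lambda>i. cochain.ip n (h i) (h i)"
    let ?c = "\<lambda>i. 1 - P i / real (n - i)"
    have "walk_form n ?G \<le> real n * real (Suc n) * (\<Sum>i<n. ?c i * ?q i)"
      unfolding P_def using Suc.prems(1-4) h by (intro Suc.IH) auto
    then have "(real (Suc n))\<^sup>2 * cochain.ip (Suc n) (up n ?G) (up n ?G)
      \<le> real (Suc n) * (\<Sum>i<n. ?q i) + real n * real (Suc n) * (\<Sum>i<n. ?c i * ?q i)"
      using up_norm[of n ?G] plev_norm_sum[OF h] Suc.prems(1) by simp
    also have "\<dots> = (real (Suc n))\<^sup>2 * (\<Sum>i<n. (1 + real n * ?c i) / real (Suc n) * ?q i)"
    proof -
      have "(\<Sum>i<n. (1 + real n * ?c i) / real (Suc n) * ?q i)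
        = (\<Sum>i<n. (?q i + real n * (?c i * ?q i)) / real (Suc n))"
        by (intro sum.cong refl) (simp only: distrib_right mult_1_left times_divide_eq_left mult.assoc)
      also have "\<dots> = ((\<Sum>i<n. ?q i) + real n * (\<Sum>i<n. ?c i * ?q i)) / real (Suc n)"
        by (simp only: sum_divide_distrib[symmetric] sum.distrib sum_distrib_left)
      finally have eq: "(\<Sum>i<n. (1 + real n * ?c i) / real (Suc n) * ?q i)
        = ((\<Sum>i<n. ?q i) + real n * (\<Sum>i<n. ?c i * ?q i)) / real (Suc n)" .
      have "e * a + m * e * c = e\<^sup>2 * ((a + m * c) / e)" if "e \<noteq> 0" for a c e m :: real
        using that by (simp add: field_simps power2_eq_square)
      then show ?thesis unfolding eq by simp
    qed
    also have "\<dots> \<le> (real (Suc n))\<^sup>2 * (\<Sum>i<n. b i * ?q i)"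
    proof (intro mult_left_mono sum_mono mult_right_mono)
      fix i assume "i \<in> {..<n}"
      then have i: "i < n" by simp
      define r where "r = real (n - i)"
      have r: "0 < r" "real (Suc n - i) = r + 1" "real n = r + real i" using i by (auto simp: r_def)
      have "P i / (r + 1) \<le> real n / real (Suc n) * (P i / r)"
      \<comment> \<open>For \<open>i = 0\<close> the two sides agree, so the unknown sign of
        \<open>P 0\<close> does no harm.\<close>
      proof (cases "i = 0")
        case True
        then show ?thesis using r by (simp add: add.commute)
      next
        case False
        have "1 / (r + 1) \<le> m / (1 + m) / r" if "r \<le> m" for m
        proof -
          have "0 < (1 + m) * r" "(1 + m) * r / (r + 1) \<le> m"
            using that r(1) by (simp, subst pos_divide_le_eq) (simp_all add: algebra_simps)
          then have "1 / (r + 1) \<le> m / ((1 + m) * r)"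
            by (simp add: pos_le_divide_eq)
          then show ?thesis by simp
        qed
        from this[of "real n"] have "1 / (r + 1) \<le> real n / real (Suc n) / r"
          using r(3) by simp
        then show ?thesis
          using mult_right_mono[OF _ P_nonneg[of i]] False by fastforce
      qed
      moreover have "(1 + real n * (1 - x)) / real (Suc n) = 1 - real n / real (Suc n) * x" for x
        by (simp add: field_simps)
      ultimately show "(1 + real n * ?c i) / real (Suc n) \<le> b i"
        unfolding b_def r(2) r_def[symmetric] by (simp only: diff_left_mono)
    qed (simp_all add: cochain.ip_nonneg)
    finally show ?thesis by (simp add: mult_le_cancel_left_pos del: of_nat_Suc)
  qed
  let ?F = "\<Sum>i<Suc n. f i" and ?q = "\<lambda>i. cochain.ip (Suc n) (f i) (f i)"
  have fl: "plev (Suc n) i (f i)" if "i \<le> n" for i using Suc.prems(5) that by simp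
  have down: "cochain.ip n (down n ?F) (down n ?F) \<le> (\<Sum>i<n. b i * ?q i)"
    unfolding lessThan_Suc_atMost using pos anti up by (intro down_norm_le fl) auto
  have "walk_form (Suc n) ?F \<le> real (Suc n) * real (n + 2) *
      (g n * cochain.ip (Suc n) ?F ?F + (1 - g n) * cochain.ip n (down n ?F) (down n ?F))"
    using Suc.prems(1,2) by (intro walk_form_le) auto
  also have "\<dots> \<le> real (Suc n) * real (n + 2) * (g n * (\<Sum>i<Suc n. ?q i) + (1 - g n) * (\<Sum>i<n. b i * ?q i))"
  proof (rule mult_left_mono[OF add_mono])
    show "g n * cochain.ip (Suc n) ?F ?F \<le> g n * (\<Sum>i<Suc n. ?q i)"
      using plev_norm_sum[OF Suc.prems(5)] by simp
    show "(1 - g n) * cochain.ip n (down n ?F) (down n ?F) \<le> (1 - g n) * (\<Sum>i<n. b i * ?q i)"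
    \<comment> \<open>For \<open>n = 0\<close> the factor \<open>1 - g 0\<close> could be negative,
      but \<open>down\<close> sends a cochain of level 0 on vertices to 0. For larger
      \<open>n\<close> the factor is nonnegative.\<close>
    proof (cases "n = 0")
      case True
      have "lev 1 0 ?F" using fl[of 0] True by (simp add: plev_def)
      then have "down n ?F = 0" using lev_self lev_down True by fastforce
      then show ?thesis using True by (simp only: wip_zero_left) simp
    next
      case False
      then show ?thesis using down Suc.prems(4)[of n] by (intro mult_left_mono) auto
    qed
  qed simp
  \<comment> \<open>The combination \<open>g n + (1 - g n) * b i\<close> restores the missing factor
    of the product. The top level \<open>i = n\<close> gets only \<open>g n\<close>, which is its
    coefficient because its product has a single factor.\<close>
  also have "g n * (\<Sum>i<Suc n. ?q i) + (1 - g n) * (\<Sum>i<n. b i * ?q i)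
    = (\<Sum>i<Suc n. (1 - (\<Prod>s=i..<Suc n. 1 - g s) / real (Suc n - i)) * ?q i)"
  proof -
    have "(\<Sum>i<n. (1 - (\<Prod>s=i..<Suc n. 1 - g s) / real (Suc n - i)) * ?q i)
      = (\<Sum>i<n. g n * ?q i + (1 - g n) * (b i * ?q i))"
    proof (intro sum.cong refl)
      fix i assume "i \<in> {..<n}"
      then have prod: "(\<Prod>s=i..<Suc n. 1 - g s) = P i * (1 - g n)" by (simp add: P_def)
      have "(1 - x * (1 - t) / e) * y = t * y + (1 - t) * ((1 - x / e) * y)" for x t e y :: real
        by (simp add: algebra_simps diff_divide_distrib)
      then show "(1 - (\<Prod>s=i..<Suc n. 1 - g s) / real (Suc n - i)) * ?q i
        = g n * ?q i + (1 - g n) * (b i * ?q i)"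
        unfolding b_def prod .
    qed
    moreover have "1 - (\<Prod>s=n..<Suc n. 1 - g s) / real (Suc n - n) = g n" by simp
    ultimately show ?thesis
      by (simp only: sum.lessThan_Suc sum.distrib sum_distrib_left[symmetric] distrib_left add_ac)
  qed
  finally show ?case by simp
qed

end

section \<open>Translation from cardinalities back to dimensions\<close>

theorem mainTheorem1:
  fixes X :: "'a set set" and w :: "'a set \<Rightarrow> real" and d k :: int
    and lam :: "'a set \<Rightarrow> real" and \<gamma> :: "int \<Rightarrow> real" and f :: "int \<Rightarrow> 'a set \<Rightarrow> real"
  assumes complex: "weighted_complex X d w"
    and lam: "\<And>\<sigma>. \<sigma> \<in> X \<Longrightarrow> face_dim \<sigma> < d - 2 \<Longrightarrow> link_lambda2 X w \<sigma> \<le> lam \<sigma>"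
    and gamma: "\<And>j. -1 \<le> j \<Longrightarrow> j \<le> d - 3 \<Longrightarrow> \<gamma> j = Max (lam ` faces X j)"
    and gamma_le_1: "\<And>j. 0 \<le> j \<Longrightarrow> j \<le> k - 1 \<Longrightarrow> \<gamma> j \<le> 1"
    and k: "0 \<le> k" "k \<le> d - 2"
    and f: "\<And>i. 0 \<le> i \<Longrightarrow> i \<le> k \<Longrightarrow> proper_level X w k i (f i)"
  shows "cochain_inner X w k (nonlazy_walk X w k (\<Sum>i=0..k. f i)) (\<Sum>i=0..k. f i)
     \<le> (\<Sum>i=0..k. (1 - 1 / of_int (k - i + 1) * (\<Prod>j=i-1..k-1. 1 - \<gamma> j)) * (cochain_norm X w k (f i))\<^sup>2)"
proof -
  interpret weighted_simplicial_complex X d w using complex by unfold_locales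
  define n where "n = nat (k + 1)"
  have kn: "k = int n - 1" "0 < n" using k(1) by (auto simp: n_def)
  have nN: "n + 1 < N" using k(2) kn d_eq by linarith
  define g where "g s = \<gamma> (int s - 1)" for s
  have lam_le: "link_lambda2 X w \<sigma> \<le> g s" if s: "s < n" and \<sigma>: "\<sigma> \<in> sized s" for s \<sigma>
  proof -
    have "link_lambda2 X w \<sigma> \<le> lam \<sigma>"
      using s nN d_eq sizedD[OF \<sigma>] by (intro lam) (auto simp: face_dim_def)
    also have "\<dots> \<le> Max (lam ` sized s)" using \<sigma> finite_sized by simp
    also have "\<dots> = g s"
      using gamma[of "int s - 1"] s nN d_eq by (simp add: g_def faces_eq_sized)
    finally show ?thesis .
  qed
  have low: "-1 \<le> g s * real (N - s - 1)" if s: "s < n" for s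
  proof (cases "0 \<le> g s")
    case True
    then have "0 \<le> g s * real (N - s - 1)" by simp
    then show ?thesis by linarith
  next
    case False
    \<comment> \<open>A negative maximum forces the eigenvalue of any one face of this size to be
      negative, so its lower bound passes up to \<open>g s\<close>.\<close>
    obtain \<sigma> where \<sigma>: "\<sigma> \<in> sized s" using sized_nonempty[of s] s nN by auto
    have "-1 \<le> link_lambda2 X w \<sigma> * real (N - s - 1)"
      using link_lambda2_lower_bound[OF \<sigma>] lam_le[OF s \<sigma>] False s nN by simp
    also have "\<dots> \<le> g s * real (N - s - 1)"
      using lam_le[OF s \<sigma>] by (intro mult_right_mono) auto
    finally show ?thesis .
  qed
  have "x \<in> int ` {..<n}" if "0 \<le> x" "x < int n" for x
    using that by (intro image_eqI[of _ _ "nat x"]) auto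
  then have range: "{0..k} = int ` {..<n}"
    by (auto simp: kn(1))
  have sum: "(\<Sum>i=0..k. h i) = (\<Sum>i<n. h (int i))" for h :: "int \<Rightarrow> 'b::comm_monoid_add"
    unfolding range by (simp add: sum.reindex)
  \<comment> \<open>Dimension \<open>j\<close> corresponds to cardinality \<open>s = j + 1\<close>;
    as \<open>k = n - 1\<close>, the upper end \<open>k - 1\<close> becomes
    \<open>n - 1\<close>.\<close>
  have prod: "(\<Prod>j=int i-1..k-1. 1 - \<gamma> j) = (\<Prod>s=i..<n. 1 - g s)" for i
    by (rule prod.reindex_bij_witness[where i = "\<lambda>s. int s - 1" and j = "\<lambda>j. nat (j + 1)"])
      (auto simp: g_def kn)
  have pf: "plev n i (f (int i))" if "i < n" for i
    using f[of "int i"] proper_level_iff[OF that] that kn by simp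
  have norm: "(cochain_norm X w k h)\<^sup>2 = cochain.ip n h h" for h
    using cochain.ip_nonneg[of n h] by (simp add: cochain_norm_def kn cochain_inner_eq)
  let ?F = "\<Sum>i<n. f (int i)"
  let ?R = "\<Sum>i<n. (1 - (\<Prod>s=i..<n. 1 - g s) / real (n - i)) * cochain.ip n (f (int i)) (f (int i))"
  have "real n * real (Suc n) * cochain.ip n (nonlazy_walk X w k ?F) ?F \<le> real n * real (Suc n) * ?R"
    unfolding kn(1) walk_form_eq[OF kn(2), symmetric]
  proof (rule walk_form_proper_le)
    show "g s \<le> 1" if "0 < s" "s < n" for s
      using gamma_le_1[of "int s - 1"] that kn by (simp add: g_def)
  qed (use nN lam_le low pf in auto)
  then have "cochain.ip n (nonlazy_walk X w k ?F) ?F \<le> ?R"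
    using kn(2) by (simp add: mult_le_cancel_left_pos del: of_nat_Suc)
  also have "?R = (\<Sum>i=0..k. (1 - 1 / of_int (k - i + 1) * (\<Prod>j=i-1..k-1. 1 - \<gamma> j)) * (cochain_norm X w k (f i))\<^sup>2)"
    unfolding sum norm prod using kn by (intro sum.cong refl) (simp add: of_nat_diff)
  finally show ?thesis
    unfolding sum by (simp add: kn(1) cochain_inner_eq)
qed

end
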